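(* Consider the isosceles Schwarzschild three body problem in regularized coordinates $(r,v,\theta,w)$, under the parameter assumptions stated in the context. Let $h<0$ be fixed. Then any solution (on the energy level $h$) with an initial condition $(r_0,v_0,\theta_0,w_0)$, $r_0>0$, $|\theta_0|<\pi/2$, such that $$2r_0^2\,\tilde V(0)<\frac{C^2}{2}\quad\text{and}\quad v_0<0,\qquad\text{where }\ \tilde V(\theta):=V(\theta)\cos\theta,$$ tends either to a double collision manifold $\mathcal B_{\pm}(r)$ with $0<r<r_0$, or to the triple collision manifold $\Delta$ (including the sets $\mathcal B_\pm(0)$).
   Context: Two equal point masses $M$ move in a horizontal plane symmetrically about their midpoint $O$, and a third point mass $m$ moves on the vertical axis through $O$. The mutual interactions are of Schwarzschild type, with potential $U_0(R,z)=-\frac{A}{R}-\frac{B}{R^3}-\frac{4A_1}{(R^2+4z^2)^{1/2}}-\frac{16B_1}{(R^2+4z^2)^{3/2}}$, $A,A_1,B,B_1>0$, where $R$ is the distance between the equal masses and $z$ the height of $m$. $C$ is the angular momentum and $h$ the total energy. Put $\mu:=\frac{2M+m}{m}$. It is assumed that $M\gg m$ (so $\mu\gg1$), $\mu>1+\frac{A}{4A_1}$, $\mu>1+\frac{B}{16B_1}$ and $(\mu-1)^{4/15}\left(\frac{4A_1}{A}\right)^{2/3}\neq\left(\frac{16B_1}{B}\right)^{2/5}$. One sets $R=r\sqrt{2/M}\,\cos\theta$, $z=r\sqrt{\frac{2M+m}{2Mm}}\,\sin\theta$ with $r\ge0$, $\theta\in[-\pi/2,\pi/2]$; $v$ and $w$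 are rescaled velocity variables. Let $$V(\theta)=\left(\tfrac M2\right)^{1/2}\left(\tfrac{A}{\cos\theta}+\tfrac{4A_1}{(\cos^2\theta+\mu\sin^2\theta)^{1/2}}\right),\qquad W(\theta)=\left(\tfrac M2\right)^{3/2}\left(\tfrac{B}{\cos^3\theta}+\tfrac{16B_1}{(\cos^2\theta+\mu\sin^2\theta)^{3/2}}\right),$$ and $U(\theta)=W(\theta)\cos^3\theta>0$. (The functions $U$, $\tilde V$ and products such as $V\cos^3\theta$, $V'\cos^6\theta$ are extended continuously to $\theta=\pm\pi/2$.) The regularized equations of motion on $[0,\infty)\times\mathbb R\times[-\pi/2,\pi/2]\times\mathbb R$ are $$r'=rv\,\frac{\cos^3\theta}{\sqrt{U(\theta)}},\qquad v'=\left(\frac{\cos^3\theta}{2\sqrt{U(\theta)}}v^2-\sqrt{U(\theta)}\right)+r^2\left(2hr+V(\theta)\right)\frac{\cos^3\theta}{\sqrt{U(\theta)}},\qquad \theta'=w,$$ $$w'=\frac12 vw\frac{\cos^3\theta}{\sqrt{U(\theta)}}+r^2V'(\theta)\frac{\cos^6\theta}{U(\theta)}+\frac{U'(\theta)}{U(\theta)}\left(\cos^3\theta-\frac{w^2}{2}\right)+3\sin\theta\cos^2\theta-\frac{C^2r\sin\theta\cos^3\theta}{U(\theta)},$$ together with the energy relation $$2hr^3\cos^6\theta=U(\theta)w^2+\left(v^2\cos^3\theta-2U(\theta)\right)\cos^3\theta+\left(C^2-2rV(\theta)\cos^2\theta\right)r\cos^4\theta .$$ The triple collision manifold is $\Delta=\{(r,v,\theta,w):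 r=0,\ w^2+\frac{\cos^6\theta}{U(\theta)}v^2=2\cos^3\theta\}$. For $\rho\ge0$, $\mathcal B_\pm(\rho)=\{(r,v,\theta,w): r=\rho,\ \theta=\pm\frac\pi2,\ w=0\}$; for $\rho>0$ these are the double collision manifolds (the equal masses collide while $m$ is above, respectively below, the horizontal plane). "Tends to" means that the solution asymptotically approaches the set as the regularized time increases.
   Formalization: The condition 2r_0^2 Ṽ(0) < C^2/2 is corrected to 2r_0 Ṽ(0) < C^2/2 (as printed the claim fails on homothetic orbits with r_0 < 1); besides the printed w'-equation, the one with the extra term -3 w^2 tan θ, which preserves the energy relation, is also covered. *)

theory Defs
  imports "HOL-Analysis.Analysis"
begin

definition mass_ratio :: "real \<Rightarrow> real \<Rightarrow> real" where
  "mass_ratio M m = (2 * M + m) / m"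

definition V :: "real \<Rightarrow> real \<Rightarrow> real \<Rightarrow> real \<Rightarrow> real \<Rightarrow> real" where
  "V M m A A1 \<theta> = sqrt (M / 2) *
     (A / cos \<theta> + 4 * A1 / sqrt ((cos \<theta>)\<^sup>2 + mass_ratio M m * (sin \<theta>)\<^sup>2))"

definition W :: "real \<Rightarrow> real \<Rightarrow> real \<Rightarrow> real \<Rightarrow> real \<Rightarrow> real" where
  "W M m B B1 \<theta> = (M / 2) powr (3/2) *
     (B / cos \<theta> ^ 3 + 16 * B1 / ((cos \<theta>)\<^sup>2 + mass_ratio M m * (sin \<theta>)\<^sup>2) powr (3/2))"

(* The products V * cos and W * cos^3 extended continuously to \<theta> = +-pi/2.
   They cannot be defined as literal products: x / 0 = 0 would give the value 0 there.
   Products such as V * cos^3 and V' * cos^6 have continuous extensions that vanish at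
   +-pi/2, which is what the literal product yields. *)

definition Vt :: "real \<Rightarrow> real \<Rightarrow> real \<Rightarrow> real \<Rightarrow> real \<Rightarrow> real" where
  "Vt M m A A1 \<theta> = sqrt (M / 2) *
     (A + 4 * A1 * cos \<theta> / sqrt ((cos \<theta>)\<^sup>2 + mass_ratio M m * (sin \<theta>)\<^sup>2))"

definition U :: "real \<Rightarrow> real \<Rightarrow> real \<Rightarrow> real \<Rightarrow> real \<Rightarrow> real" where
  "U M m B B1 \<theta> = (M / 2) powr (3/2) *
     (B + 16 * B1 * cos \<theta> ^ 3 / ((cos \<theta>)\<^sup>2 + mass_ratio M m * (sin \<theta>)\<^sup>2) powr (3/2))"

lemma Vt_eq: "\<bar>\<theta>\<bar> < pi / 2 \<Longrightarrow> Vt M m A A1 \<theta> = V M m A A1 \<theta> * cos \<theta>"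
proof -
  assume "\<bar>\<theta>\<bar> < pi / 2"
  then have "cos \<theta> \<noteq> 0" using cos_gt_zero_pi[of \<theta>] by linarith
  then show ?thesis by (simp add: Vt_def V_def distrib_right)
qed

lemma U_eq: "\<bar>\<theta>\<bar> < pi / 2 \<Longrightarrow> U M m B B1 \<theta> = W M m B B1 \<theta> * cos \<theta> ^ 3"
proof -
  assume "\<bar>\<theta>\<bar> < pi / 2"
  then have "cos \<theta> \<noteq> 0" using cos_gt_zero_pi[of \<theta>] by linarith
  then show ?thesis by (simp add: U_def W_def distrib_right)
qed

lemma cos2_mass_ratio_sin2_pos:
  assumes "M > 0" "m > 0"
  shows "(cos \<theta>)\<^sup>2 + mass_ratio M m * (sin \<theta>)\<^sup>2 > 0"
proof -
  have "mass_ratio M m > 0" using assms by (simp add: mass_ratio_def)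
  moreover have "cos \<theta> \<noteq> 0 \<or> sin \<theta> \<noteq> 0"
    using sin_cos_squared_add[of \<theta>] by fastforce
  ultimately show ?thesis
    by (auto intro: add_pos_nonneg add_nonneg_pos)
qed

lemma continuous_Vt: "M > 0 \<Longrightarrow> m > 0 \<Longrightarrow> continuous_on S (Vt M m A A1)"
  unfolding Vt_def
  by (intro continuous_intros) (simp_all add: less_imp_neq[OF cos2_mass_ratio_sin2_pos, symmetric])

lemma continuous_U: "M > 0 \<Longrightarrow> m > 0 \<Longrightarrow> continuous_on S (U M m B B1)"
  unfolding U_def
  by (intro continuous_intros) (simp_all add: less_imp_neq[OF cos2_mass_ratio_sin2_pos, symmetric])


type_synonym state = "real \<times> real \<times> real \<times> real"

definition state_space :: "state set" where
  "state_space = {(r, v, \<theta>, w). r \<ge> 0 \<and> - (pi / 2) \<le> \<theta> \<and> \<theta> \<le> pi / 2}"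

(* The regularized vector field. The last term of w' is absent (k = 0) from the published
   form of the equations. Differentiating w = \<theta>' along the isosceles flow gives k = 3, and
   only for k = 3 is the energy relation below invariant: on it, the derivative of
   (right-hand side - left-hand side) is 2 * (3 - k) * U * w^3 * tan \<theta>. At \<theta> = +-pi/2 the
   term is 0 by tan (+-pi/2) = 0; on the energy relation w^2 = O(cos^3 \<theta>) for bounded r,
   so this is the continuous extension. *)
definition vfield ::
  "real \<Rightarrow> real \<Rightarrow> real \<Rightarrow> real \<Rightarrow> real \<Rightarrow> real \<Rightarrow> real \<Rightarrow> real \<Rightarrow> real \<Rightarrow> state \<Rightarrow> state" where
  "vfield k M m A A1 B B1 C h = (\<lambda>(r, v, \<theta>, w).
     let u = U M m B B1 \<theta>; u' = deriv (U M m B B1) \<theta>;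
         p = V M m A A1 \<theta>; p' = deriv (V M m A A1) \<theta>
     in (r * v * (cos \<theta> ^ 3 / sqrt u),
         (cos \<theta> ^ 3 / (2 * sqrt u) * v\<^sup>2 - sqrt u)
           + r\<^sup>2 * (2 * h * r + p) * (cos \<theta> ^ 3 / sqrt u),
         w,
         1/2 * v * w * (cos \<theta> ^ 3 / sqrt u) + r\<^sup>2 * p' * (cos \<theta> ^ 6 / u)
           + u' / u * (cos \<theta> ^ 3 - w\<^sup>2 / 2) + 3 * sin \<theta> * (cos \<theta>)\<^sup>2
           - C\<^sup>2 * r * sin \<theta> * cos \<theta> ^ 3 / u
           - k * tan \<theta> * w\<^sup>2))"

definition energy_relation ::
  "real \<Rightarrow> real \<Rightarrow> real \<Rightarrow> real \<Rightarrow> real \<Rightarrow> real \<Rightarrow> real \<Rightarrow> real \<Rightarrow> state \<Rightarrow> bool" where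
  "energy_relation M m A A1 B B1 C h = (\<lambda>(r, v, \<theta>, w).
     2 * h * r ^ 3 * cos \<theta> ^ 6 =
       U M m B B1 \<theta> * w\<^sup>2
       + (v\<^sup>2 * cos \<theta> ^ 3 - 2 * U M m B B1 \<theta>) * cos \<theta> ^ 3
       + (C\<^sup>2 - 2 * r * V M m A A1 \<theta> * (cos \<theta>)\<^sup>2) * r * cos \<theta> ^ 4)"

definition solves_on :: "(state \<Rightarrow> state) \<Rightarrow> real set \<Rightarrow> (real \<Rightarrow> state) \<Rightarrow> bool" where
  "solves_on F I x \<longleftrightarrow>
     (\<forall>t\<in>I. x t \<in> state_space \<and> (x has_vector_derivative F (x t)) (at t within I))"

(* A forward solution issued from time 0 that cannot be continued to a longer time interval. *)
definition maximal_forward_solution ::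
  "(state \<Rightarrow> state) \<Rightarrow> real set \<Rightarrow> (real \<Rightarrow> state) \<Rightarrow> bool" where
  "maximal_forward_solution F I x \<longleftrightarrow>
     is_interval I \<and> 0 \<in> I \<and> I \<subseteq> {0..} \<and> solves_on F I x \<and>
     \<not> (\<exists>J y. is_interval J \<and> J \<subseteq> {0..} \<and> I \<subset> J \<and> solves_on F J y \<and> (\<forall>t\<in>I. y t = x t))"

definition triple_collision_manifold ::
  "real \<Rightarrow> real \<Rightarrow> real \<Rightarrow> real \<Rightarrow> state set" where
  "triple_collision_manifold M m B B1 = {(r, v, \<theta>, w) \<in> state_space.
     r = 0 \<and> w\<^sup>2 + cos \<theta> ^ 6 / U M m B B1 \<theta> * v\<^sup>2 = 2 * cos \<theta> ^ 3}"

definition B_plus :: "real \<Rightarrow> state set" where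
  "B_plus \<rho> = {(r, v, \<theta>, w). r = \<rho> \<and> \<theta> = pi / 2 \<and> w = 0}"

definition B_minus :: "real \<Rightarrow> state set" where
  "B_minus \<rho> = {(r, v, \<theta>, w). r = \<rho> \<and> \<theta> = - (pi / 2) \<and> w = 0}"

lemma B_plus_0_subset: "B_plus 0 \<subseteq> triple_collision_manifold M m B B1"
  by (clarsimp simp: B_plus_def triple_collision_manifold_def state_space_def
      simp del: eq_divide_eq_numeral1)

lemma B_minus_0_subset: "B_minus 0 \<subseteq> triple_collision_manifold M m B B1"
  by (clarsimp simp: B_minus_def triple_collision_manifold_def state_space_def)

definition tends_to_set :: "(real \<Rightarrow> state) \<Rightarrow> state set \<Rightarrow> bool" where
  "tends_to_set x S \<longleftrightarrow> ((\<lambda>t. infdist (x t) S) \<longlongrightarrow> 0) at_top"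

end

theory Submission
  imports Defs
begin

text \<open>
Multiplied out, the energy relation says that
\[ U w^2 + v^2\cos^6\theta + C^2 r\cos^4\theta + 2|h| r^3\cos^6\theta
   = 2U\cos^3\theta + 2r^2\tilde V\cos^5\theta , \]
a sum of nonnegative terms on the left and a multiple of \<open>cos\<^sup>3 \<theta>\<close> on the right.
As long as \<open>r\<close> is bounded this gives \<open>w\<^sup>2 = O(cos\<^sup>3 \<theta>)\<close>, hence \<open>\<theta>' = w = O(cos \<theta>)\<close>, and
the double collision angles $\pm\pi/2$ are not reached in finite time.

Using the same relation to eliminate \<open>v\<^sup>2\<close> from the equation for \<open>v'\<close>, one finds
\[ \sqrt U\,v' = 3hr^3\cos^3\theta - \frac{U w^2}{2\cos^3\theta}
   - r\cos\theta\Bigl(\frac{C^2}{2} - 2r\tilde V\cos\theta\Bigr) . \]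
Since \<open>h < 0\<close> and $\tilde V$ is largest at the angle 0, every term is nonpositive while
\<open>r \<le> r\<^sub>0\<close>; and \<open>r\<close> decreases while \<open>v < 0\<close>. The two facts sustain each other, so
\<open>r \<le> r\<^sub>0\<close> and \<open>v \<le> v\<^sub>0 < 0\<close> along the whole orbit (\<open>v_neg\<close>, \<open>r_antimono\<close>, \<open>v_le_init\<close>).

On a bounded time interval the orbit therefore stays in a compact part of the region
\<open>\<bar>\<theta>\<bar> < \<pi>/2\<close>, where the vector field is locally Lipschitz, and a maximal solution is
defined for all forward time (\<open>compact_confinement\<close>, \<open>maximal_forward_solution_global\<close>).

The decreasing function \<open>r\<close> has a limit \<open>\<rho> \<ge> 0\<close>. If \<open>\<rho> > 0\<close>, then \<open>r' \<le> - \<kappa> cos\<^sup>3 \<theta>\<close> with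
\<open>\<kappa> > 0\<close>, and boundedness of \<open>r\<close> forces the Lipschitz function \<open>cos \<theta>\<close> to tend to 0; then
\<open>\<bar>\<theta>\<bar> \<longrightarrow> \<pi>/2\<close> and \<open>w \<longrightarrow> 0\<close>, with a fixed sign of \<open>\<theta>\<close> by continuity. If \<open>\<rho> = 0\<close>, the energy
relation shows that the defect in the equation of the triple collision manifold is \<open>O(r)\<close>.
A small defect means a small distance to the manifold: near \<open>cos \<theta> = 0\<close> because the manifold
contains the sets \<open>B_plus 0\<close> and \<open>B_minus 0\<close>, elsewhere because \<open>(v, w)\<close> can be rescaled onto it.
\<close>

section \<open>Monotonicity and limits of real functions\<close>

lemma nondecreasing_within:
  fixes f :: "real \<Rightarrow> real"
  assumes "a \<le> b" and der: "\<And>s. s \<in> {a..b} \<Longrightarrow> (f has_real_derivative f' s) (at s within {a..b})"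
    and nonneg: "\<And>s. s \<in> {a..b} \<Longrightarrow> f' s \<ge> 0"
  shows "f a \<le> f b"
proof (rule DERIV_nonneg_imp_increasing_open[OF \<open>a \<le> b\<close>])
  show "\<exists>y. (f has_real_derivative y) (at s) \<and> y \<ge> 0" if "a < s" "s < b" for s
  proof (intro exI conjI)
    have "at s within {a..b} = at s" using that by (intro at_within_interior) simp
    then show "(f has_real_derivative f' s) (at s)" using der[of s] that by simp
    show "f' s \<ge> 0" using nonneg[of s] that by simp
  qed
  show "continuous_on {a..b} f"
    using der by (intro DERIV_continuous_on)
qed

text \<open>A differential form of Gronwall's inequality: \<open>f s * exp (L * s)\<close> is nondecreasing.
It keeps \<open>r\<close> and \<open>cos \<theta>\<close> away from 0 on bounded time intervals.\<close>

lemma exponential_lower_bound: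
  fixes f :: "real \<Rightarrow> real"
  assumes "a \<le> b" and der: "\<And>s. s \<in> {a..b} \<Longrightarrow> (f has_real_derivative f' s) (at s within {a..b})"
    and decay: "\<And>s. s \<in> {a..b} \<Longrightarrow> f' s \<ge> - L * f s"
  shows "f b \<ge> f a * exp (- L * (b - a))"
proof -
  have "f a * exp (L * (a - a)) \<le> f b * exp (L * (b - a))"
  proof (rule nondecreasing_within[OF \<open>a \<le> b\<close>])
    show "((\<lambda>s. f s * exp (L * (s - a))) has_real_derivative (f' s + L * f s) * exp (L * (s - a)))
      (at s within {a..b})" if "s \<in> {a..b}" for s
      by (rule derivative_eq_intros der[OF that] refl)+ (simp add: algebra_simps)
    show "0 \<le> (f' s + L * f s) * exp (L * (s - a))" if "s \<in> {a..b}" for s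
      using decay[OF that] by simp
  qed
  then have "f a * exp (- L * (b - a)) \<le> f b * exp (L * (b - a)) * exp (- L * (b - a))"
    by (intro mult_right_mono) auto
  also have "\<dots> = f b" by (simp flip: exp_add add: mult.assoc)
  finally show ?thesis .
qed

lemma nonincreasing_bounded_tendsto:
  fixes f :: "real \<Rightarrow> real"
  assumes mono: "\<And>s t. 0 \<le> s \<Longrightarrow> s \<le> t \<Longrightarrow> f t \<le> f s" and lb: "\<And>t. 0 \<le> t \<Longrightarrow> b \<le> f t"
  obtains l where "b \<le> l" "\<And>t. 0 \<le> t \<Longrightarrow> l \<le> f t" "(f \<longlongrightarrow> l) at_top"
proof
  define l where "l = Inf (f ` {0..})"
  have bdd: "bdd_below (f ` {0..})" using lb by (auto simp: bdd_below_def)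
  show "b \<le> l" unfolding l_def using lb by (intro cInf_greatest) auto
  show le: "l \<le> f t" if "0 \<le> t" for t unfolding l_def using that bdd by (intro cInf_lower) auto
  show "(f \<longlongrightarrow> l) at_top"
  proof (rule order_tendstoI)
    fix a assume "a < l"
    show "eventually (\<lambda>t. a < f t) at_top"
      using eventually_ge_at_top[of 0] by eventually_elim (use le \<open>a < l\<close> in fastforce)
  next
    fix a assume "l < a"
    then obtain s where s: "s \<ge> 0" "f s < a"
      unfolding l_def using cInf_less_iff[OF _ bdd, of a] by auto
    show "eventually (\<lambda>t. f t < a) at_top"
      using eventually_ge_at_top[of s] by eventually_elim (use mono s in fastforce)
  qed
qed

text \<open>An instance of Barbalat's argument: if \<open>f\<close> were at least \<open>e\<close> at arbitrarily late times, then,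
being Lipschitz, it would exceed \<open>e / 2\<close> for a fixed length of time afterwards, and \<open>r\<close> would
drop by a fixed amount each time, contradicting its convergence from above.\<close>

lemma rate_tendsto_zero:
  fixes r f :: "real \<Rightarrow> real"
  assumes der: "\<And>t. 0 \<le> t \<Longrightarrow> (r has_real_derivative r' t) (at t within {0..})"
    and rate: "\<And>t. 0 \<le> t \<Longrightarrow> r' t \<le> - \<kappa> * f t ^ n" and "\<kappa> > 0"
    and pos: "\<And>t. 0 \<le> t \<Longrightarrow> f t \<ge> 0"
    and lip: "\<And>s t. 0 \<le> s \<Longrightarrow> s \<le> t \<Longrightarrow> \<bar>f t - f s\<bar> \<le> L * (t - s)" and "L > 0"
    and lim: "(r \<longlongrightarrow> \<rho>) at_top" and ge: "\<And>t. 0 \<le> t \<Longrightarrow> \<rho> \<le> r t"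
  shows "(f \<longlongrightarrow> 0) at_top"
proof (rule tendstoI)
  fix e :: real assume "e > 0"
  \<comment> \<open>a time span over which \<open>f\<close> varies by at most \<open>e / 2\<close>; if \<open>f\<close> starts above \<open>e\<close>, then \<open>r\<close> drops by at least \<open>\<eta>\<close> meanwhile\<close>
  define d where "d = e / (2 * L)"
  have "d > 0" using \<open>e > 0\<close> \<open>L > 0\<close> by (simp add: d_def)
  define \<eta> where "\<eta> = \<kappa> * (e / 2) ^ n * d"
  have "\<eta> > 0" using \<open>\<kappa> > 0\<close> \<open>e > 0\<close> \<open>d > 0\<close> by (simp add: \<eta>_def)
  then have "eventually (\<lambda>t. r t < \<rho> + \<eta>) at_top" using order_tendstoD(2)[OF lim] by simp
  then show "eventually (\<lambda>t. dist (f t) 0 < e) at_top"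
    using eventually_ge_at_top[of 0]
  proof eventually_elim
    case (elim t)
    show ?case
    proof (rule ccontr)
      assume "\<not> dist (f t) 0 < e"
      then have ft: "f t \<ge> e" using pos[of t] elim by simp
      have half: "f s \<ge> e / 2" if "s \<in> {t..t+d}" for s
      proof -
        have "\<bar>f s - f t\<bar> \<le> L * (s - t)" using lip[of t s] that elim by simp
        also have "\<dots> \<le> L * d" using that \<open>L > 0\<close> by (intro mult_left_mono) auto
        finally have "\<bar>f s - f t\<bar> \<le> e / 2" using \<open>L > 0\<close> by (simp add: d_def)
        with ft abs_ge_minus_self[of "f s - f t"] show ?thesis by linarith
      qed
      have "- r t - \<kappa> * (e / 2) ^ n * t \<le> - r (t + d) - \<kappa> * (e / 2) ^ n * (t + d)"
      proof (rule nondecreasing_within[where a = t and b = "t + d"])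
        show "((\<lambda>s. - r s - \<kappa> * (e / 2) ^ n * s) has_real_derivative - r' s - \<kappa> * (e / 2) ^ n)
           (at s within {t..t+d})" if "s \<in> {t..t+d}" for s
          using that elim
          by (auto intro!: derivative_eq_intros DERIV_subset[OF der])
        show "0 \<le> - r' s - \<kappa> * (e / 2) ^ n" if "s \<in> {t..t+d}" for s
        proof -
          have "\<kappa> * (e / 2) ^ n \<le> \<kappa> * f s ^ n"
            using half[OF that] \<open>e > 0\<close> \<open>\<kappa> > 0\<close> by (intro mult_left_mono power_mono) auto
          then show ?thesis using rate[of s] that elim by simp
        qed
      qed (use \<open>d > 0\<close> in auto)
      then have "r (t + d) \<le> r t - \<eta>" by (simp add: \<eta>_def algebra_simps)
      moreover have "\<rho> \<le> r (t + d)" using ge[of "t + d"] elim \<open>d > 0\<close> by simp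
      ultimately show False using elim by simp
    qed
  qed
qed

section \<open>Functions that are Lipschitz near a point\<close>

text \<open>The hypothesis of the Picard theorem at a single point. Unlike differentiability with a
continuous derivative, it is inherited by composite terms one operation at a time, without
computing derivatives in several variables.\<close>

definition lipschitz_near :: "('a::metric_space \<Rightarrow> 'b::metric_space) \<Rightarrow> 'a \<Rightarrow> bool" where
  "lipschitz_near f p \<longleftrightarrow> (\<exists>e>0. \<exists>L. L-lipschitz_on (cball p e) f)"

lemma lipschitz_nearI: "e > 0 \<Longrightarrow> L-lipschitz_on (cball p e) f \<Longrightarrow> lipschitz_near f p"
  unfolding lipschitz_near_def by blast

lemma lipschitz_near_small:
  assumes "lipschitz_near f p" "open S" "p \<in> S"
  obtains e L where "e > 0" "cball p e \<subseteq> S" "L-lipschitz_on (cball p e) f"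
proof -
  obtain d L where "d > 0" "L-lipschitz_on (cball p d) f"
    using assms(1) by (auto simp: lipschitz_near_def)
  moreover obtain e where "e > 0" "cball p e \<subseteq> S"
    using assms(2,3) open_contains_cball by blast
  ultimately show ?thesis
    by (intro that[of "min d e" L]) (auto intro: lipschitz_on_subset)
qed

lemma lipschitz_near_imp_isCont: "lipschitz_near f p \<Longrightarrow> isCont f p"
proof -
  assume "lipschitz_near f p"
  then obtain e L where "e > 0" "L-lipschitz_on (cball p e) f"
    by (auto simp: lipschitz_near_def)
  then have "continuous_on (ball p e) f"
    by (meson ball_subset_cball continuous_on_subset lipschitz_on_continuous_on)
  with \<open>e > 0\<close> show ?thesis by (simp add: continuous_on_eq_continuous_at)
qed

lemma lipschitz_near_cong:
  assumes "lipschitz_near g p" "open S" "p \<in> S" "\<And>x. x \<in> S \<Longrightarrow> f x = g x"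
  shows "lipschitz_near f p"
proof -
  obtain e L where e: "e > 0" "cball p e \<subseteq> S" "L-lipschitz_on (cball p e) g"
    using lipschitz_near_small[OF assms(1-3)] .
  then have "L-lipschitz_on (cball p e) f"
    using assms(4) by (auto intro: lipschitz_on_transform)
  with e(1) show ?thesis by (rule lipschitz_nearI)
qed

named_theorems lipschitz_near_intros

lemma lipschitz_near_const [lipschitz_near_intros]: "lipschitz_near (\<lambda>x. c) p"
  using lipschitz_on_constant by (auto simp: lipschitz_near_def intro: zero_less_one)

lemma lipschitz_near_id [lipschitz_near_intros]: "lipschitz_near (\<lambda>x. x) p"
  using lipschitz_on_id by (auto simp: lipschitz_near_def intro: zero_less_one)

lemma lipschitz_near_pairwise:
  assumes "lipschitz_near f p" "lipschitz_near g p"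
  obtains e K L where "e > 0" "K-lipschitz_on (cball p e) f" "L-lipschitz_on (cball p e) g"
proof -
  obtain d K where d: "d > 0" "K-lipschitz_on (cball p d) f"
    using assms(1) by (auto simp: lipschitz_near_def)
  obtain e L where e: "e > 0" "cball p e \<subseteq> ball p d" "L-lipschitz_on (cball p e) g"
    using lipschitz_near_small[OF assms(2), of "ball p d"] d(1) by auto
  have "cball p e \<subseteq> cball p d" using e(2) ball_subset_cball by blast
  then show ?thesis using that e d lipschitz_on_subset by blast
qed

lemma lipschitz_near_Pair [lipschitz_near_intros]:
  assumes "lipschitz_near f p" "lipschitz_near g p"
  shows "lipschitz_near (\<lambda>x. (f x, g x)) p"
  by (rule lipschitz_near_pairwise[OF assms]) (rule lipschitz_nearI[OF _ lipschitz_on_Pair])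

lemma lipschitz_near_compose:
  assumes "lipschitz_near g (f p)" "lipschitz_near f p"
  shows "lipschitz_near (\<lambda>x. g (f x)) p"
proof -
  obtain d K where d: "d > 0" "K-lipschitz_on (cball (f p) d) g"
    using assms(1) by (auto simp: lipschitz_near_def)
  obtain e L where e: "e > 0" "L-lipschitz_on (cball p e) f"
    using assms(2) by (auto simp: lipschitz_near_def)
  have L: "L \<ge> 0" using e(2) by (rule lipschitz_on_nonneg)
  define r where "r = min e (d / (L + 1))"
  have r: "r > 0" using L e d by (simp add: r_def)
  have re: "L-lipschitz_on (cball p r) f"
    using e(2) by (rule lipschitz_on_subset) (auto simp: r_def)
  have "f ` cball p r \<subseteq> cball (f p) d"
  proof clarify
    fix x assume x: "x \<in> cball p r"
    have "dist (f p) (f x) \<le> L * dist p x"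
      using lipschitz_onD[OF re, of p x] x r by auto
    also have "\<dots> \<le> L * (d / (L + 1))" using x L by (intro mult_left_mono) (auto simp: r_def)
    also have "\<dots> \<le> d" using L d by (simp add: divide_simps algebra_simps)
    finally show "f x \<in> cball (f p) d" by simp
  qed
  then have "(K * L)-lipschitz_on (cball p r) (\<lambda>x. g (f x))"
    using lipschitz_on_compose2[OF re lipschitz_on_subset[OF d(2)]] by blast
  with r show ?thesis by (rule lipschitz_nearI)
qed

lemma lipschitz_near_fst [lipschitz_near_intros]:
  assumes "lipschitz_near f p"
  shows "lipschitz_near (\<lambda>x. fst (f x)) p"
proof (rule lipschitz_near_compose[where g = fst, OF _ assms])
  have "1-lipschitz_on S fst" for S :: "('b \<times> 'c) set"
    by (rule lipschitz_onI) (simp_all add: dist_fst_le)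
  then show "lipschitz_near fst (f p)"
    by (rule lipschitz_nearI[OF zero_less_one])
qed

lemma lipschitz_near_snd [lipschitz_near_intros]:
  assumes "lipschitz_near f p"
  shows "lipschitz_near (\<lambda>x. snd (f x)) p"
proof (rule lipschitz_near_compose[where g = snd, OF _ assms])
  have "1-lipschitz_on S snd" for S :: "('b \<times> 'c) set"
    by (rule lipschitz_onI) (simp_all add: dist_snd_le)
  then show "lipschitz_near snd (f p)"
    by (rule lipschitz_nearI[OF zero_less_one])
qed

lemma lipschitz_near_add [lipschitz_near_intros]:
  fixes f g :: "'a::metric_space \<Rightarrow> 'b::real_normed_vector"
  assumes "lipschitz_near f p" "lipschitz_near g p"
  shows "lipschitz_near (\<lambda>x. f x + g x) p"
  by (rule lipschitz_near_pairwise[OF assms]) (rule lipschitz_nearI[OF _ lipschitz_on_add])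

lemma lipschitz_near_minus [lipschitz_near_intros]:
  fixes f :: "'a::metric_space \<Rightarrow> 'b::real_normed_vector"
  assumes "lipschitz_near f p"
  shows "lipschitz_near (\<lambda>x. - f x) p"
  using assms unfolding lipschitz_near_def by (auto intro: lipschitz_on_minus)

lemma lipschitz_near_diff [lipschitz_near_intros]:
  fixes f g :: "'a::metric_space \<Rightarrow> 'b::real_normed_vector"
  assumes "lipschitz_near f p" "lipschitz_near g p"
  shows "lipschitz_near (\<lambda>x. f x - g x) p"
  using lipschitz_near_add[OF assms(1) lipschitz_near_minus[OF assms(2)]] by simp

text \<open>The only place where derivatives enter the calculus: functions of one real variable.\<close>

lemma lipschitz_near_C1:
  fixes g g' :: "real \<Rightarrow> real"
  assumes "open S" "a \<in> S" "\<And>x. x \<in> S \<Longrightarrow> (g has_real_derivative g' x) (at x)" "continuous_on S g'"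
  shows "lipschitz_near g a"
proof -
  obtain e where e: "e > 0" "cball a e \<subseteq> S" using assms(1,2) open_contains_cball by blast
  have "compact (g' ` cball a e)"
    using assms(4) e(2) by (intro compact_continuous_image compact_cball) (rule continuous_on_subset)
  then have "bounded (g' ` cball a e)" by (rule compact_imp_bounded)
  then obtain b where "\<forall>z\<in>g' ` cball a e. norm z \<le> b" unfolding bounded_iff ..
  then have b: "\<bar>g' x\<bar> \<le> b" if "x \<in> cball a e" for x using that by auto
  have b0: "b \<ge> 0" using b[of a] e(1) by auto
  have "b-lipschitz_on (cball a e) g"
  proof (rule bounded_derivative_imp_lipschitz)
    show "(g has_derivative (*) (g' x)) (at x within cball a e)" if "x \<in> cball a e" for x
      using assms(3)[of x] that e(2) unfolding has_field_derivative_def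
      by (blast intro: has_derivative_at_withinI)
    show "onorm ((*) (g' x)) \<le> b" if "x \<in> cball a e" for x
      using b[OF that] b0 by (intro onorm_bound) (auto simp: abs_mult intro!: mult_right_mono)
  qed (use b0 in auto)
  with e(1) show ?thesis by (rule lipschitz_nearI)
qed

lemma lipschitz_near_power2:
  fixes f :: "'a::metric_space \<Rightarrow> real"
  assumes "lipschitz_near f p"
  shows "lipschitz_near (\<lambda>x. (f x)\<^sup>2) p"
proof (rule lipschitz_near_compose[OF _ assms])
  show "lipschitz_near (\<lambda>z. z\<^sup>2) (f p)"
    by (rule lipschitz_near_C1[of UNIV _ _ "\<lambda>z. 2 * z"]) 
      (auto intro!: derivative_eq_intros continuous_intros)
qed

text \<open>By polarisation, products reduce to sums and squares, and a square is a smooth function of one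
variable.\<close>

lemma lipschitz_near_mult [lipschitz_near_intros]:
  fixes f g :: "'a::metric_space \<Rightarrow> real"
  assumes "lipschitz_near f p" "lipschitz_near g p"
  shows "lipschitz_near (\<lambda>x. f x * g x) p"
proof -
  have "lipschitz_near (\<lambda>x. (1/4) * ((f x + g x)\<^sup>2 - (f x - g x)\<^sup>2)) p"
  proof (rule lipschitz_near_compose[where g = "\<lambda>z. (1/4) * z"])
    show "lipschitz_near ((*) (1/4)) q" for q :: real
      by (rule lipschitz_near_C1[of UNIV _ _ "\<lambda>z. 1/4"]) 
        (auto intro!: derivative_eq_intros continuous_intros)
  qed (intro lipschitz_near_intros lipschitz_near_power2 assms)
  also have "(\<lambda>x. (1/4) * ((f x + g x)\<^sup>2 - (f x - g x)\<^sup>2)) = (\<lambda>x. f x * g x)"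
    by (simp add: fun_eq_iff power2_eq_square algebra_simps)
  finally show ?thesis .
qed

lemma lipschitz_near_power [lipschitz_near_intros]:
  fixes f :: "'a::metric_space \<Rightarrow> real"
  assumes "lipschitz_near f p"
  shows "lipschitz_near (\<lambda>x. f x ^ n) p"
  by (induction n) (auto intro!: lipschitz_near_intros assms)

lemma lipschitz_near_divide [lipschitz_near_intros]:
  fixes f g :: "'a::metric_space \<Rightarrow> real"
  assumes "lipschitz_near f p" "lipschitz_near g p" "g p \<noteq> 0"
  shows "lipschitz_near (\<lambda>x. f x / g x) p"
  unfolding divide_inverse
proof (intro lipschitz_near_mult assms(1) lipschitz_near_compose[where g = inverse, OF _ assms(2)])
  show "lipschitz_near inverse (g p)"
    by (rule lipschitz_near_C1[of "- {0}" _ _ "\<lambda>z. - inverse (z\<^sup>2)"])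
      (auto intro!: derivative_eq_intros continuous_intros simp: assms(3) power2_eq_square)
qed

lemma lipschitz_near_sqrt [lipschitz_near_intros]:
  assumes "lipschitz_near f p" "f p > 0"
  shows "lipschitz_near (\<lambda>x. sqrt (f x)) p"
proof (rule lipschitz_near_compose[where g = sqrt, OF _ assms(1)])
  show "lipschitz_near sqrt (f p)"
    by (rule lipschitz_near_C1[of "{0<..}" _ _ "\<lambda>z. inverse (sqrt z) / 2"])
      (auto intro!: derivative_eq_intros continuous_intros simp: assms(2))
qed

lemma lipschitz_near_powr [lipschitz_near_intros]:
  fixes f :: "'a::metric_space \<Rightarrow> real"
  assumes "lipschitz_near f p" "f p > 0"
  shows "lipschitz_near (\<lambda>x. f x powr a) p"
proof (rule lipschitz_near_compose[where g = "\<lambda>z. z powr a", OF _ assms(1)])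
  show "lipschitz_near (\<lambda>z. z powr a) (f p)"
    by (rule lipschitz_near_C1[of "{0<..}" _ _ "\<lambda>z. a * z powr (a - 1)"])
      (auto intro!: derivative_eq_intros continuous_intros simp: assms(2))
qed

lemma lipschitz_near_cos [lipschitz_near_intros]:
  assumes "lipschitz_near f p"
  shows "lipschitz_near (\<lambda>x. cos (f x :: real)) p"
proof (rule lipschitz_near_compose[where g = cos, OF _ assms(1)])
  show "lipschitz_near cos (f p)"
    by (rule lipschitz_near_C1[of UNIV _ _ "\<lambda>z. - sin z"]) (auto intro!: continuous_intros)
qed

lemma lipschitz_near_sin [lipschitz_near_intros]:
  assumes "lipschitz_near f p"
  shows "lipschitz_near (\<lambda>x. sin (f x :: real)) p"
proof (rule lipschitz_near_compose[where g = sin, OF _ assms(1)])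
  show "lipschitz_near sin (f p)"
    by (rule lipschitz_near_C1[of UNIV _ _ cos]) (auto intro!: continuous_intros)
qed

section \<open>Existence and continuation of solutions\<close>

text \<open>Precomposing \<open>F\<close> with the nearest-point projection onto the ball, which does not increase
distances, yields a globally Lipschitz and bounded field. For a short time the integral operator
of that field is a contraction of the space of bounded continuous functions, and its fixed point
does not leave the ball, where the two fields agree.\<close>

lemma picard_local_solution:
  fixes F :: "'a::euclidean_space \<Rightarrow> 'a" and T :: real
  assumes "e > 0" and lip: "L-lipschitz_on (cball p e) F"
  obtains d y where "d > 0" "y T = p"
    "\<And>t. t \<in> {T..T+d} \<Longrightarrow> y t \<in> cball p e"
    "\<And>t. t \<in> {T..T+d} \<Longrightarrow> (y has_vector_derivative F (y t)) (at t within {T..T+d})"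
proof -
  define G where "G = F \<circ> closest_point (cball p e)"
  have ne: "cball p e \<noteq> {}" using \<open>e > 0\<close> by auto
  have "L \<ge> 0" using lip by (rule lipschitz_on_nonneg)
  have cp: "closest_point (cball p e) z \<in> cball p e" for z
    using ne by (intro closest_point_in_set) auto
  have GL: "dist (G a) (G b) \<le> L * dist a b" for a b
  proof -
    have "dist (G a) (G b) \<le> L * dist (closest_point (cball p e) a) (closest_point (cball p e) b)"
      unfolding G_def o_def by (rule lipschitz_onD[OF lip cp cp])
    also have "\<dots> \<le> L * dist a b"
      using closest_point_lipschitz[OF convex_cball closed_cball ne] \<open>L \<ge> 0\<close>
      by (intro mult_left_mono) auto
    finally show ?thesis .
  qed
  have GF: "G z = F z" if "z \<in> cball p e" for z
    using that by (simp add: G_def closest_point_self)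
  define b where "b = norm (F p) + L * e"
  have "b \<ge> 0" using \<open>L \<ge> 0\<close> \<open>e > 0\<close> by (simp add: b_def)
  have Gb: "norm (G z) \<le> b" for z
  proof -
    have "dist (F (closest_point (cball p e) z)) (F p) \<le> L * dist (closest_point (cball p e) z) p"
      using lipschitz_onD[OF lip cp, of p] \<open>e > 0\<close> by auto
    also have "\<dots> \<le> L * e" using cp[of z] \<open>L \<ge> 0\<close> 
      by (intro mult_left_mono) (auto simp: dist_commute)
    finally have "norm (G z - F p) \<le> L * e" by (simp add: G_def dist_norm)
    then show ?thesis unfolding b_def using norm_triangle_sub[of "G z" "F p"] by linarith
  qed
  have Gc: "continuous_on UNIV G"
    by (rule lipschitz_on_continuous_on[of L]) (use GL \<open>L \<ge> 0\<close> in \<open>auto intro: lipschitz_onI\<close>)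
  have Gf: "continuous_on S (\<lambda>s. G (f s))" if "continuous_on S f" for S :: "real set" and f
    using continuous_on_compose2[OF Gc that] by auto
  \<comment> \<open>the first bound makes the operator a contraction, the second keeps the solution in the ball\<close>
  define d where "d = min (1 / (2 * (L + 1))) (e / (b + 1))"
  have "d > 0" using \<open>L \<ge> 0\<close> \<open>b \<ge> 0\<close> \<open>e > 0\<close> by (simp add: d_def)
  have "d * L \<le> 1 / (2 * (L + 1)) * L" using \<open>L \<ge> 0\<close> by (intro mult_right_mono) (auto simp: d_def)
  also have "\<dots> \<le> 1 / 2" using \<open>L \<ge> 0\<close> by (simp add: divide_simps)
  finally have dL: "d * L \<le> 1 / 2" .
  have "b * d \<le> b * (e / (b + 1))" using \<open>b \<ge> 0\<close> by (intro mult_left_mono) (auto simp: d_def)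
  also have "\<dots> \<le> e" using \<open>b \<ge> 0\<close> \<open>e > 0\<close> by (simp add: divide_simps algebra_simps)
  finally have db: "b * d \<le> e" .
  \<comment> \<open>clamping time to \<open>{T..T+d}\<close> turns the problem into one about functions on the whole line\<close>
  define c where "c t = max T (min (T + d) t)" for t
  have c: "c t \<in> {T..T+d}" for t using \<open>d > 0\<close> by (auto simp: c_def)
  define P where "P f t = p + integral {T..c t} (\<lambda>s. G (f s))" for f :: "real \<Rightarrow> 'a" and t
  have Pcont: "continuous_on UNIV (P f)" if "continuous_on UNIV f" for f
  proof -
    have "continuous_on {T..T+d} (\<lambda>u. integral {T..u} (\<lambda>s. G (f s)))"
      by (intro indefinite_integral_continuous_1 integrable_continuous_real Gf)
        (use that continuous_on_subset in blast)
    moreover have "continuous_on UNIV c" unfolding c_def by (intro continuous_intros)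
    ultimately have "continuous_on UNIV (\<lambda>t. integral {T..c t} (\<lambda>s. G (f s)))"
      using c by (intro continuous_on_compose2[of "{T..T+d}" "\<lambda>u. integral {T..u} (\<lambda>s. G (f s))" UNIV c]) auto
    then show ?thesis unfolding P_def by (intro continuous_intros)
  qed
  have intb: "norm (integral {T..c t} (\<lambda>s. G (f s))) \<le> b * d" if "continuous_on UNIV f" for f t
  proof -
    have "norm (integral {T..c t} (\<lambda>s. G (f s))) \<le> b * (c t - T)"
      using c[of t] Gb by (intro integral_bound Gf continuous_on_subset[OF that]) auto
    also have "\<dots> \<le> b * d" using c[of t] \<open>b \<ge> 0\<close> by (intro mult_left_mono) auto
    finally show ?thesis .
  qed
  have PB: "P (apply_bcontfun f) \<in> bcontfun" for f
    using Pcont[of f] 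
  proof (intro bcontfun_normI)
    show "norm (P f t) \<le> norm p + b * d" for t
      unfolding P_def using norm_triangle_ineq[of p] intb[of f t] 
      by (smt (verit, best) continuous_on_apply_bcontfun)
  qed auto
  define Q where "Q f = Bcontfun (P (apply_bcontfun f))" for f
  have Q: "apply_bcontfun (Q f) = P (apply_bcontfun f)" for f
    unfolding Q_def using PB by (rule Bcontfun_inverse)
  have "dist (Q f) (Q g) \<le> 1/2 * dist f g" for f g
  proof (rule dist_bound)
    fix t
    have ig: "(\<lambda>s. G (apply_bcontfun f s)) integrable_on {T..c t}" for f
      by (intro integrable_continuous_real Gf) auto
    have "dist (apply_bcontfun (Q f) t) (apply_bcontfun (Q g) t)
      = norm (integral {T..c t} (\<lambda>s. G (apply_bcontfun f s) - G (apply_bcontfun g s)))"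
      by (simp add: Q P_def dist_norm integral_diff[OF ig ig])
    also have "\<dots> \<le> (L * dist f g) * (c t - T)"
    proof (rule integral_bound)
      show "norm (G (apply_bcontfun f s) - G (apply_bcontfun g s)) \<le> L * dist f g" for s
        using GL[of "apply_bcontfun f s" "apply_bcontfun g s"] dist_bounded[of f s g] \<open>L \<ge> 0\<close>
        by (smt (verit) dist_norm mult_left_mono)
    qed (use c[of t] in \<open>auto intro!: continuous_intros Gf\<close>)
    also have "\<dots> \<le> (L * dist f g) * d"
      using c[of t] \<open>L \<ge> 0\<close> by (intro mult_left_mono) auto
    also have "\<dots> = (d * L) * dist f g" by simp
    also have "\<dots> \<le> 1/2 * dist f g" using dL by (intro mult_right_mono) auto
    finally show "dist (apply_bcontfun (Q f) t) (apply_bcontfun (Q g) t) \<le> 1/2 * dist f g" .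
  qed
  then obtain f where f: "Q f = f"
    using banach_fix_type[of "1/2" Q] by auto
  define y where "y = apply_bcontfun f"
  have yP: "y t = p + integral {T..c t} (\<lambda>s. G (y s))" for t
    using fun_cong[OF Q[of f, unfolded f], of t] by (simp add: y_def P_def)
  have yc: "continuous_on S y" for S by (simp add: y_def)
  have yball: "y t \<in> cball p e" for t
    using intb[OF yc, of t] db yP[of t] by (simp add: dist_norm)
  show ?thesis
  proof
    show "d > 0" by fact
    show "y T = p" using yP[of T] \<open>d > 0\<close> by (simp add: c_def)
    show "y t \<in> cball p e" for t by (rule yball)
    fix t assume t: "t \<in> {T..T+d}"
    have "((\<lambda>u. integral {T..u} (\<lambda>s. G (y s))) has_vector_derivative G (y t)) (at t within {T..T+d})"
      by (rule integral_has_vector_derivative[OF Gf[OF yc] t])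
    then have "((\<lambda>u. p + integral {T..u} (\<lambda>s. G (y s))) has_vector_derivative G (y t)) (at t within {T..T+d})"
      using has_vector_derivative_add[OF has_vector_derivative_const] by fastforce
    then have "(y has_vector_derivative G (y t)) (at t within {T..T+d})"
      by (rule has_vector_derivative_transform[OF t, rotated]) (subst yP, auto simp: c_def)
    then show "(y has_vector_derivative F (y t)) (at t within {T..T+d})"
      using GF[OF yball] by simp
  qed
qed

lemma nonneg_interval_cases:
  fixes I :: "real set"
  assumes "is_interval I" "0 \<in> I" "I \<subseteq> {0..}"
  obtains "I = {0..}" | T where "T \<ge> 0" "I = {0..T}" | T where "T > 0" "I = {0..<T}"
proof (cases "bdd_above I")
  case False
  have "t \<in> I" if "t \<ge> 0" for t
    using False assms that unfolding is_interval_1 bdd_above_def 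
    by (meson linorder_not_le order_less_imp_le)
  then show ?thesis using assms that(1) by auto
next
  case True
  define T where "T = Sup I"
  have le: "t \<le> T" if "t \<in> I" for t unfolding T_def using that True by (rule cSup_upper)
  have less: "t \<in> I" if t: "0 \<le> t" "t < T" for t
  proof -
    obtain y where "y \<in> I" "t < y"
      using t(2) less_cSup_iff[OF _ True, of t] assms(2) unfolding T_def by auto
    then show ?thesis using assms(1,2) t(1) unfolding is_interval_1 by (meson order_less_imp_le)
  qed
  show ?thesis
  proof (cases "T \<in> I")
    case True
    then have "I = {0..T}" using le less assms(3) by (auto simp: subset_iff) (metis le_less)
    then show ?thesis using that(2) True assms by auto
  next
    case False
    then have "I = {0..<T}" using le less assms(3) by (auto simp: subset_iff) (metis le_less)
    moreover have "T > 0" using le[OF assms(2)] False assms(2) by (metis le_less)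
    ultimately show ?thesis using that(3) by auto
  qed
qed

text \<open>Confinement to a compact set bounds the velocity, so \<open>x\<close> is Lipschitz and has a limit at \<open>T\<close>.
The derivative at \<open>T\<close> comes from the integral form of the equation, which passes to the limit.\<close>

lemma extend_solution_to_endpoint:
  fixes F :: "'a::euclidean_space \<Rightarrow> 'a"
  assumes "T > 0" and K: "compact K" "continuous_on K F"
    and xK: "\<And>t. t \<in> {0..<T} \<Longrightarrow> x t \<in> K"
    and der: "\<And>t. t \<in> {0..<T} \<Longrightarrow> (x has_vector_derivative F (x t)) (at t within {0..<T})"
  obtains y where "\<And>t. t \<in> {0..<T} \<Longrightarrow> y t = x t" "\<And>t. t \<in> {0..T} \<Longrightarrow> y t \<in> K"
    "\<And>t. t \<in> {0..T} \<Longrightarrow> (y has_vector_derivative F (y t)) (at t within {0..T})"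
proof -
  have "bounded (F ` K)" by (intro compact_imp_bounded compact_continuous_image K)
  then obtain b where b: "\<And>z. z \<in> K \<Longrightarrow> norm (F z) \<le> b" by (auto simp: bounded_iff)
  have "b \<ge> 0" using b[OF xK[of 0]] \<open>T > 0\<close> by (smt (verit) atLeastLessThan_iff norm_ge_zero)
  have "b-lipschitz_on {0..<T} x"
  proof (rule bounded_derivative_imp_lipschitz)
    show "(x has_derivative (\<lambda>s. s *\<^sub>R F (x t))) (at t within {0..<T})" if "t \<in> {0..<T}" for t
      using der[OF that] by (simp add: has_vector_derivative_def)
    show "onorm (\<lambda>s. s *\<^sub>R F (x t)) \<le> b" if "t \<in> {0..<T}" for t
      using b[OF xK[OF that]] \<open>b \<ge> 0\<close>
      by (intro onorm_bound) (auto simp: mult.commute[of b] intro!: mult_left_mono)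
  qed (use \<open>b \<ge> 0\<close> in auto)
  then obtain y where y: "uniformly_continuous_on (closure {0..<T}) y"
     "\<And>t. t \<in> {0..<T} \<Longrightarrow> x t = y t"
    using uniformly_continuous_on_extension_on_closure[OF lipschitz_on_uniformly_continuous] by metis
  have cl: "closure {0..<T} = {0..T}" using \<open>T > 0\<close> by simp
  have yc: "continuous_on {0..T} y" using y(1) cl uniformly_continuous_imp_continuous by metis
  have "y ` closure {0..<T} \<subseteq> K"
    using yc cl xK y(2) compact_imp_closed[OF K(1)] by (intro image_closure_subset) auto
  then have yK: "y t \<in> K" if "t \<in> {0..T}" for t using that cl by auto
  have Fy: "continuous_on {0..T} (\<lambda>t. F (y t))"
    by (rule continuous_on_compose2[OF K(2) yc]) (use yK in auto)
  define z where "z t = y 0 + integral {0..t} (\<lambda>s. F (y s))" for t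
  have zder: "(z has_vector_derivative F (y t)) (at t within {0..T})" if "t \<in> {0..T}" for t
    unfolding z_def
    using has_vector_derivative_add[OF has_vector_derivative_const integral_has_vector_derivative[OF Fy that]]
    by fastforce
  have zc: "continuous_on {0..T} z" 
    using zder by (meson continuous_on_eq_continuous_within has_vector_derivative_continuous)
  have zy: "z t - y t = 0" if "t \<in> {0..<T}" for t
  proof -
    have "((\<lambda>s. F (y s)) has_integral (y t - y 0)) {0..t}"
    proof (rule fundamental_theorem_of_calculus)
      fix s assume s: "s \<in> {0..t}"
      have "(x has_vector_derivative F (x s)) (at s within {0..t})"
        by (rule has_vector_derivative_within_subset[OF der]) (use s that in auto)
      then show "(y has_vector_derivative F (y s)) (at s within {0..t})"
        using s that y(2) by (intro has_vector_derivative_transform[OF s, of y x]) (auto simp flip: y(2))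
    qed (use that in auto)
    then show ?thesis by (simp add: z_def integral_unique)
  qed
  have eq: "z t = y t" if "t \<in> {0..T}" for t
    using continuous_constant_on_closure[of "{0..<T}" "\<lambda>t. z t - y t" 0 t] zy that cl
    by (auto intro!: continuous_intros zc yc)
  show ?thesis
  proof
    show "y t = x t" if "t \<in> {0..<T}" for t using y(2)[OF that] by simp
    show "y t \<in> K" if "t \<in> {0..T}" for t by (rule yK[OF that])
    show "(y has_vector_derivative F (y t)) (at t within {0..T})" if t: "t \<in> {0..T}" for t
      by (rule has_vector_derivative_transform[OF t _ zder[OF t]]) (use eq in auto)
  qed
qed

text \<open>If \<open>I\<close> were \<open>{0..T}\<close>, a local solution could be attached at \<open>T\<close>; if it were \<open>{0..<T}\<close>, the
endpoint could be added. The set \<open>D\<close> is a region in which solutions can be started; the limit at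
\<open>T\<close> is merely a state where \<open>F\<close> is continuous, so \<open>K\<close> may reach beyond \<open>D\<close>.\<close>

lemma maximal_forward_solution_global:
  assumes max: "maximal_forward_solution F I x"
    and D: "open D" "D \<subseteq> state_space"
    and lip: "\<And>p. p \<in> D \<Longrightarrow> lipschitz_near F p"
    and xD: "\<And>t. t \<in> I \<Longrightarrow> x t \<in> D"
    and cmp: "\<And>T. T > 0 \<Longrightarrow> I = {0..<T} \<Longrightarrow>
      \<exists>K. compact K \<and> continuous_on K F \<and> K \<subseteq> state_space \<and> x ` I \<subseteq> K"
  shows "I = {0..}"
proof -
  have I: "is_interval I" "0 \<in> I" "I \<subseteq> {0..}" and sol: "solves_on F I x"
    and nex: "\<And>J y. is_interval J \<Longrightarrow> J \<subseteq> {0..} \<Longrightarrow> I \<subset> J \<Longrightarrow> solves_on F J y \<Longrightarrow>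
      \<forall>t\<in>I. y t = x t \<Longrightarrow> False"
    using max unfolding maximal_forward_solution_def by blast+
  from I show ?thesis
  proof (cases rule: nonneg_interval_cases)
    case (2 T)
    then have xT: "x T \<in> D" using xD by simp
    obtain e L where e: "e > 0" "cball (x T) e \<subseteq> D" "L-lipschitz_on (cball (x T) e) F"
      by (rule lipschitz_near_small[OF lip[OF xT] D(1) xT])
    obtain d y where y: "d > 0" "y T = x T"
      "\<And>t. t \<in> {T..T+d} \<Longrightarrow> y t \<in> cball (x T) e"
      "\<And>t. t \<in> {T..T+d} \<Longrightarrow> (y has_vector_derivative F (y t)) (at t within {T..T+d})"
      using picard_local_solution[OF e(1,3), of T] by metis
    define z where "z t = (if t \<in> {0..T} then x t else y t)" for t
    have zd0: "(z has_vector_derivative (if t \<in> {0..T} then F (x t) else F (y t))) (at t within {0..T+d})"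
      if t: "t \<in> {0..T+d}" for t
      unfolding z_def
    proof (rule has_vector_derivative_If_within_closures[where T = "{T..T+d}"])
      have int: "closure {0..T} \<inter> closure {T..T+d} = {T}" using \<open>d > 0\<close> \<open>T \<ge> 0\<close> by auto
      have un: "{0..T} \<union> {T} = {0..T}" "{T..T+d} \<union> {T} = {T..T+d}"
        using \<open>d > 0\<close> \<open>T \<ge> 0\<close> by auto
      show "(x has_vector_derivative F (x t)) (at t within {0..T} \<union> closure {0..T} \<inter> closure {T..T+d})"
        if "t \<in> {0..T} \<union> closure {0..T} \<inter> closure {T..T+d}"
        using sol 2 that unfolding int un by (auto simp: solves_on_def)
      show "(y has_vector_derivative F (y t)) (at t within {T..T+d} \<union> closure {0..T} \<inter> closure {T..T+d})"
        if "t \<in> {T..T+d} \<union> closure {0..T} \<inter> closure {T..T+d}"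
        using y(4) that unfolding int un by auto
      show "{0..T+d} = {0..T} \<union> {T..T+d}" using \<open>d > 0\<close> \<open>T \<ge> 0\<close> by auto
      show "t \<in> {0..T} \<union> {T..T+d}" using t by auto
      show "x t = y t" "F (x t) = F (y t)" if "t \<in> closure {0..T}" "t \<in> closure {T..T+d}"
      proof -
        have "t \<in> {T}" using that int by blast
        then show "x t = y t" "F (x t) = F (y t)" using y(2) by auto
      qed
    qed
    have zd: "(z has_vector_derivative F (z t)) (at t within {0..T+d})" if "t \<in> {0..T+d}" for t
      using zd0[OF that] by (cases "t \<in> {0..T}") (simp_all only: z_def if_True if_False)
    have "z t \<in> state_space" if "t \<in> {0..T+d}" for t
      using that sol 2 y(3)[of t] e(2) D(2) by (auto simp: z_def solves_on_def)
    with zd have "solves_on F {0..T+d} z" unfolding solves_on_def by blast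
    moreover have "I \<subset> {0..T+d}" using 2 \<open>d > 0\<close> by force
    ultimately have False
      by (intro nex[of "{0..T+d}" z]) (auto simp: z_def 2 is_interval_cc)
    then show ?thesis ..
  next
    case (3 T)
    then obtain K where K: "compact K" "continuous_on K F" "K \<subseteq> state_space" "x ` I \<subseteq> K"
      using cmp by blast
    obtain y where y: "\<And>t. t \<in> {0..<T} \<Longrightarrow> y t = x t" "\<And>t. t \<in> {0..T} \<Longrightarrow> y t \<in> K"
      "\<And>t. t \<in> {0..T} \<Longrightarrow> (y has_vector_derivative F (y t)) (at t within {0..T})"
    proof (rule extend_solution_to_endpoint[of T K F x])
      show "x t \<in> K" "(x has_vector_derivative F (x t)) (at t within {0..<T})" if "t \<in> {0..<T}" for t
        using sol K(4) that 3 by (auto simp: solves_on_def)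
    qed (use K 3 in auto)
    have "solves_on F {0..T} y" unfolding solves_on_def using K(3) y(2,3) by blast
    moreover have "I \<subset> {0..T}" using 3 by force
    ultimately have False
      by (intro nex[of "{0..T}" y]) (auto simp: y(1) 3 is_interval_cc)
    then show ?thesis ..
  qed
qed

section \<open>Regularity of the vector field\<close>

text \<open>\<open>cos\<^sup>2 \<theta> + \<mu> sin\<^sup>2 \<theta>\<close> is, up to a factor, the squared distance between the unequal masses for
\<open>r = 1\<close>.\<close>

lemma has_derivative_distance_square:
  "((\<lambda>\<theta>. (cos \<theta>)\<^sup>2 + \<mu> * (sin \<theta>)\<^sup>2) has_real_derivative 2 * (\<mu> - 1) * sin \<theta> * cos \<theta>) (at \<theta>)"
  by (auto intro!: derivative_eq_intros simp: algebra_simps)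

lemma U_has_derivative:
  fixes \<theta> :: real
  assumes "M > 0" "m > 0"
  defines "q \<equiv> (cos \<theta>)\<^sup>2 + mass_ratio M m * (sin \<theta>)\<^sup>2"
  shows "(U M m B B1 has_real_derivative (M / 2) powr (3/2) * (16 * B1 *
     (- 3 * (cos \<theta>)\<^sup>2 * sin \<theta> * q powr (3/2)
        - cos \<theta> ^ 3 * (3 / 2 * q powr (1/2) * (2 * (mass_ratio M m - 1) * sin \<theta> * cos \<theta>)))
      / (q powr (3/2) * q powr (3/2)))) (at \<theta>)"
proof -
  have q: "q > 0" unfolding q_def using cos2_mass_ratio_sin2_pos[OF assms(1,2)] .
  have dq: "((\<lambda>\<theta>. ((cos \<theta>)\<^sup>2 + mass_ratio M m * (sin \<theta>)\<^sup>2) powr (3/2)) has_real_derivative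
      3 / 2 * q powr (1/2) * (2 * (mass_ratio M m - 1) * sin \<theta> * cos \<theta>)) (at \<theta>)"
    using DERIV_fun_powr[OF has_derivative_distance_square, of \<theta> "mass_ratio M m" "3/2"] q
    by (simp add: q_def)
  have dc: "((\<lambda>\<theta>. 16 * B1 * cos \<theta> ^ 3) has_real_derivative 16 * B1 * (- 3 * (cos \<theta>)\<^sup>2 * sin \<theta>)) (at \<theta>)"
    by (auto intro!: derivative_eq_intros)
  have ne: "((cos \<theta>)\<^sup>2 + mass_ratio M m * (sin \<theta>)\<^sup>2) powr (3/2) \<noteq> 0" using q by (simp add: q_def)
  have "((\<lambda>\<theta>. (M / 2) powr (3/2) * (B + 16 * B1 * cos \<theta> ^ 3 / ((cos \<theta>)\<^sup>2 + mass_ratio M m * (sin \<theta>)\<^sup>2) powr (3/2)))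
    has_real_derivative (M / 2) powr (3/2) * (0 +
      (16 * B1 * (- 3 * (cos \<theta>)\<^sup>2 * sin \<theta>) * q powr (3/2) -
      16 * B1 * cos \<theta> ^ 3 * (3 / 2 * q powr (1/2) * (2 * (mass_ratio M m - 1) * sin \<theta> * cos \<theta>)))
      / (q powr (3/2) * q powr (3/2)))) (at \<theta>)"
    unfolding q_def
    by (intro DERIV_cmult DERIV_add DERIV_const DERIV_divide dc dq[unfolded q_def] ne)
  then show ?thesis unfolding U_def[abs_def] by (simp add: right_diff_distrib mult.assoc)
qed

lemma V_has_derivative:
  fixes \<theta> :: real
  assumes "M > 0" "m > 0" "\<bar>\<theta>\<bar> < pi / 2"
  defines "q \<equiv> (cos \<theta>)\<^sup>2 + mass_ratio M m * (sin \<theta>)\<^sup>2"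
  shows "(V M m A A1 has_real_derivative sqrt (M / 2) *
     (A * sin \<theta> / (cos \<theta>)\<^sup>2
       - 4 * A1 * (inverse (sqrt q) / 2 * (2 * (mass_ratio M m - 1) * sin \<theta> * cos \<theta>)) / (sqrt q * sqrt q))) (at \<theta>)"
proof -
  have q: "q > 0" unfolding q_def using cos2_mass_ratio_sin2_pos[OF assms(1,2)] .
  have c: "cos \<theta> > 0" using assms(3) by (intro cos_gt_zero_pi) auto
  have dq: "((\<lambda>\<theta>. sqrt ((cos \<theta>)\<^sup>2 + mass_ratio M m * (sin \<theta>)\<^sup>2)) has_real_derivative
      inverse (sqrt q) / 2 * (2 * (mass_ratio M m - 1) * sin \<theta> * cos \<theta>)) (at \<theta>)"
    unfolding q_def
    by (rule DERIV_chain2[OF DERIV_real_sqrt has_derivative_distance_square]) (use q in \<open>simp add: q_def\<close>)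
  have ne: "sqrt ((cos \<theta>)\<^sup>2 + mass_ratio M m * (sin \<theta>)\<^sup>2) \<noteq> 0" "cos \<theta> \<noteq> 0" using q c by (auto simp: q_def)
  have "((\<lambda>\<theta>. sqrt (M / 2) * (A / cos \<theta> + 4 * A1 / sqrt ((cos \<theta>)\<^sup>2 + mass_ratio M m * (sin \<theta>)\<^sup>2)))
    has_real_derivative sqrt (M / 2) * ((0 * cos \<theta> - A * (- sin \<theta>)) / (cos \<theta> * cos \<theta>) +
      (0 * sqrt q - 4 * A1 * (inverse (sqrt q) / 2 * (2 * (mass_ratio M m - 1) * sin \<theta> * cos \<theta>)))
      / (sqrt q * sqrt q))) (at \<theta>)"
    unfolding q_def
    by (intro DERIV_cmult DERIV_add DERIV_const DERIV_divide DERIV_cos dq[unfolded q_def] ne)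
  then show ?thesis unfolding V_def[abs_def] by (simp add: power2_eq_square)
qed

text \<open>Both bounds come from \<open>0 \<le> cos\<^sup>2 \<theta> \<le> cos\<^sup>2 \<theta> + \<mu> sin\<^sup>2 \<theta>\<close>. The lower one is positive up to and
including \<open>cos \<theta> = 0\<close>, so the factors \<open>1 / U\<close> in the equations stay bounded.\<close>

lemma U_bounds:
  assumes "M > 0" "m > 0" "B > 0" "B1 > 0" "cos \<theta> \<ge> 0"
  shows "(M / 2) powr (3/2) * B \<le> U M m B B1 \<theta>"
    and "U M m B B1 \<theta> \<le> (M / 2) powr (3/2) * (B + 16 * B1)"
    and "U M m B B1 \<theta> > 0"
proof -
  define q where "q = (cos \<theta>)\<^sup>2 + mass_ratio M m * (sin \<theta>)\<^sup>2"
  have q: "q > 0" unfolding q_def by (rule cos2_mass_ratio_sin2_pos[OF assms(1,2)])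
  have "(cos \<theta>)\<^sup>2 \<le> q" using assms by (simp add: q_def mass_ratio_def)
  then have "((cos \<theta>)\<^sup>2) powr (3/2) \<le> q powr (3/2)" by (intro powr_mono2) auto
  moreover have "((cos \<theta>)\<^sup>2) powr (3/2) = cos \<theta> ^ 3"
  proof (cases "cos \<theta> = 0")
    case False
    then have "cos \<theta> > 0" using assms(5) by simp
    then have "(cos \<theta>)\<^sup>2 = cos \<theta> powr 2" by (simp add: powr_numeral)
    then have "((cos \<theta>)\<^sup>2) powr (3/2) = cos \<theta> powr 3" by (simp add: powr_powr)
    with \<open>cos \<theta> > 0\<close> show ?thesis by (simp add: powr_numeral)
  qed simp
  ultimately have "cos \<theta> ^ 3 / q powr (3/2) \<le> 1" using q by (simp add: divide_simps)
  then have "16 * B1 * (cos \<theta> ^ 3 / q powr (3/2)) \<le> 16 * B1 * 1" 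
    using assms(4) by (intro mult_left_mono) auto
  moreover have "0 \<le> 16 * B1 * (cos \<theta> ^ 3 / q powr (3/2))"
    using assms(4,5) by (intro mult_nonneg_nonneg) auto
  moreover have U: "U M m B B1 \<theta> = (M / 2) powr (3/2) * (B + 16 * B1 * (cos \<theta> ^ 3 / q powr (3/2)))"
    by (simp add: U_def q_def)
  ultimately show 1: "(M / 2) powr (3/2) * B \<le> U M m B B1 \<theta>"
    and "U M m B B1 \<theta> \<le> (M / 2) powr (3/2) * (B + 16 * B1)"
    unfolding U by (auto intro!: mult_left_mono)
  have "0 < (M / 2) powr (3/2) * B" using assms by simp
  with 1 show "U M m B B1 \<theta> > 0" by linarith
qed

lemma Vt_bounds:
  assumes "M > 0" "m > 0" "A > 0" "A1 > 0" "cos \<theta> \<ge> 0"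
  shows "0 \<le> Vt M m A A1 \<theta>" and "Vt M m A A1 \<theta> \<le> Vt M m A A1 0"
proof -
  define q where "q = (cos \<theta>)\<^sup>2 + mass_ratio M m * (sin \<theta>)\<^sup>2"
  have q: "q > 0" unfolding q_def by (rule cos2_mass_ratio_sin2_pos[OF assms(1,2)])
  have "(cos \<theta>)\<^sup>2 \<le> q" using assms by (simp add: q_def mass_ratio_def)
  then have "cos \<theta> \<le> sqrt q" by (rule real_le_rsqrt)
  then have "cos \<theta> / sqrt q \<le> 1" using q by (simp add: divide_simps)
  then have "4 * A1 * (cos \<theta> / sqrt q) \<le> 4 * A1 * 1" 
    using assms(4) by (intro mult_left_mono) auto
  moreover have "0 \<le> 4 * A1 * (cos \<theta> / sqrt q)"
    using assms(4,5) q by (intro mult_nonneg_nonneg) auto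
  ultimately show "0 \<le> Vt M m A A1 \<theta>" "Vt M m A A1 \<theta> \<le> Vt M m A A1 0"
    using assms(1,3) by (auto simp: Vt_def q_def intro!: mult_left_mono mult_nonneg_nonneg)
qed

lemma lipschitz_near_deriv_U:
  assumes "M > 0" "m > 0"
  shows "lipschitz_near (deriv (U M m B B1)) \<theta>"
  unfolding DERIV_imp_deriv[OF U_has_derivative[OF assms], abs_def]
  using cos2_mass_ratio_sin2_pos[OF assms]
  by (intro lipschitz_near_intros) (auto simp: less_imp_neq[symmetric])

lemma lipschitz_near_U:
  assumes "M > 0" "m > 0"
  shows "lipschitz_near (U M m B B1) \<theta>"
  unfolding U_def[abs_def]
  using cos2_mass_ratio_sin2_pos[OF assms]
  by (intro lipschitz_near_intros) (auto simp: less_imp_neq[symmetric])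

lemma lipschitz_near_V:
  assumes "M > 0" "m > 0" "\<bar>\<theta>\<bar> < pi / 2"
  shows "lipschitz_near (V M m A A1) \<theta>"
  unfolding V_def[abs_def]
  using cos2_mass_ratio_sin2_pos[OF assms(1,2)] cos_gt_zero_pi[of \<theta>] assms(3)
  by (intro lipschitz_near_intros) (auto simp: less_imp_neq[symmetric])

lemma lipschitz_near_deriv_V:
  assumes "M > 0" "m > 0" "\<bar>\<theta>\<bar> < pi / 2"
  shows "lipschitz_near (deriv (V M m A A1)) \<theta>"
proof (rule lipschitz_near_cong)
  show "deriv (V M m A A1) \<phi> = sqrt (M / 2) * (A * sin \<phi> / (cos \<phi>)\<^sup>2
     - 4 * A1 * (inverse (sqrt ((cos \<phi>)\<^sup>2 + mass_ratio M m * (sin \<phi>)\<^sup>2)) / 2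
        * (2 * (mass_ratio M m - 1) * sin \<phi> * cos \<phi>))
       / (sqrt ((cos \<phi>)\<^sup>2 + mass_ratio M m * (sin \<phi>)\<^sup>2) * sqrt ((cos \<phi>)\<^sup>2 + mass_ratio M m * (sin \<phi>)\<^sup>2)))"
    if "\<phi> \<in> {- (pi / 2)<..<pi / 2}" for \<phi>
    using that assms by (intro DERIV_imp_deriv V_has_derivative) auto
  show "lipschitz_near (\<lambda>\<phi>. sqrt (M / 2) * (A * sin \<phi> / (cos \<phi>)\<^sup>2
     - 4 * A1 * (inverse (sqrt ((cos \<phi>)\<^sup>2 + mass_ratio M m * (sin \<phi>)\<^sup>2)) / 2
        * (2 * (mass_ratio M m - 1) * sin \<phi> * cos \<phi>))
       / (sqrt ((cos \<phi>)\<^sup>2 + mass_ratio M m * (sin \<phi>)\<^sup>2) * sqrt ((cos \<phi>)\<^sup>2 + mass_ratio M m * (sin \<phi>)\<^sup>2)))) \<theta>"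
    unfolding inverse_eq_divide
    using cos2_mass_ratio_sin2_pos[OF assms(1,2), of \<theta>] cos_gt_zero_pi[of \<theta>] assms(3)
    by (intro lipschitz_near_intros) (auto simp: less_imp_neq[symmetric])
qed (use assms in auto)

lemma vfield_lipschitz_near:
  assumes "M > 0" "m > 0" "B > 0" "B1 > 0" "\<bar>\<theta>\<bar> < pi / 2"
  shows "lipschitz_near (vfield k M m A A1 B B1 C h) (r, v, \<theta>, w)"
proof -
  have c: "cos \<theta> > 0" using assms(5) by (intro cos_gt_zero_pi) auto
  have u: "U M m B B1 \<theta> > 0" using U_bounds(3) assms c by simp
  note angle = lipschitz_near_fst[OF lipschitz_near_snd[OF lipschitz_near_snd[OF lipschitz_near_id]]]
  note rules = lipschitz_near_compose[where g = "U M m B B1", OF _ angle]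
    lipschitz_near_compose[where g = "deriv (U M m B B1)", OF _ angle]
    lipschitz_near_compose[where g = "V M m A A1", OF _ angle]
    lipschitz_near_compose[where g = "deriv (V M m A A1)", OF _ angle]
    lipschitz_near_U[OF assms(1,2)] lipschitz_near_deriv_U[OF assms(1,2)]
    lipschitz_near_V[OF assms(1,2)] lipschitz_near_deriv_V[OF assms(1,2)]
  show ?thesis
    unfolding vfield_def case_prod_beta Let_def tan_def
    by (intro rules lipschitz_near_intros) (use u c assms(5) in auto)
qed

lemma vfield_continuous_on:
  assumes "M > 0" "m > 0" "B > 0" "B1 > 0"
  shows "continuous_on {(r, v, \<theta>, w). \<bar>\<theta>\<bar> < pi / 2} (vfield k M m A A1 B B1 C h)"
  using lipschitz_near_imp_isCont[OF vfield_lipschitz_near[OF assms]]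
  by (intro continuous_at_imp_continuous_on) auto

section \<open>Orbits with small size and negative radial velocity\<close>

text \<open>A solution written in coordinates, with \<open>w\<close> governed by the energy relation: along an orbit the
relation determines \<open>w\<^sup>2\<close>, which is what bounds the motion of \<open>\<theta>\<close>.\<close>

locale collapsing_orbit =
  fixes M m A A1 B B1 C h :: real and I :: "real set" and r v \<theta> w :: "real \<Rightarrow> real"
  assumes M: "M > 0" and m: "m > 0" and A: "A > 0" and A1: "A1 > 0" and B: "B > 0" and B1: "B1 > 0"
    and h: "h < 0"
    and interval: "is_interval I" and zero_in: "0 \<in> I" and nonneg_time: "I \<subseteq> {0..}"
    and r_deriv: "\<And>t. t \<in> I \<Longrightarrow>
      (r has_real_derivative r t * v t * (cos (\<theta> t) ^ 3 / sqrt (U M m B B1 (\<theta> t)))) (at t within I)"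
    and v_deriv: "\<And>t. t \<in> I \<Longrightarrow> (v has_real_derivative
      (cos (\<theta> t) ^ 3 / (2 * sqrt (U M m B B1 (\<theta> t))) * (v t)\<^sup>2 - sqrt (U M m B B1 (\<theta> t)))
        + (r t)\<^sup>2 * (2 * h * r t + V M m A A1 (\<theta> t)) * (cos (\<theta> t) ^ 3 / sqrt (U M m B B1 (\<theta> t))))
      (at t within I)"
    and \<theta>_deriv: "\<And>t. t \<in> I \<Longrightarrow> (\<theta> has_real_derivative w t) (at t within I)"
    and energy: "\<And>t. t \<in> I \<Longrightarrow> energy_relation M m A A1 B B1 C h (r t, v t, \<theta> t, w t)"
    and r_nonneg: "\<And>t. t \<in> I \<Longrightarrow> r t \<ge> 0"
    and \<theta>_range: "\<And>t. t \<in> I \<Longrightarrow> \<bar>\<theta> t\<bar> \<le> pi / 2"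
    and r_init: "r 0 > 0" and \<theta>_init: "\<bar>\<theta> 0\<bar> < pi / 2" and v_init: "v 0 < 0"
    and small: "2 * r 0 * Vt M m A A1 0 < C\<^sup>2 / 2"
begin

abbreviation c :: "real \<Rightarrow> real" where "c t \<equiv> cos (\<theta> t)"
abbreviation u :: "real \<Rightarrow> real" where "u t \<equiv> U M m B B1 (\<theta> t)"
abbreviation p :: "real \<Rightarrow> real" where "p t \<equiv> Vt M m A A1 (\<theta> t)"

definition "U_min = (M / 2) powr (3/2) * B"
definition "U_max = (M / 2) powr (3/2) * (B + 16 * B1)"
definition "V_max = Vt M m A A1 0"

lemma c_nonneg: "t \<in> I \<Longrightarrow> c t \<ge> 0"
  using \<theta>_range[of t] by (intro cos_ge_zero) auto

lemma U_min_pos: "U_min > 0" using M B by (simp add: U_min_def)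
lemma U_max_pos: "U_max > 0" using M B B1 by (simp add: U_max_def add_pos_pos)

lemma u_bounds: "t \<in> I \<Longrightarrow> U_min \<le> u t" "t \<in> I \<Longrightarrow> u t \<le> U_max" "t \<in> I \<Longrightarrow> u t > 0"
  unfolding U_min_def U_max_def using U_bounds[OF M m B B1 c_nonneg] by auto

lemma p_bounds: "t \<in> I \<Longrightarrow> 0 \<le> p t" "t \<in> I \<Longrightarrow> p t \<le> V_max"
  unfolding V_max_def using Vt_bounds[OF M m A A1 c_nonneg] by auto

lemma V_max_nonneg: "V_max \<ge> 0" using p_bounds[OF zero_in] by linarith

text \<open>The terms of the energy relation, sorted by sign. Writing \<open>V cos \<theta>\<close> as \<open>p\<close> removes the pole of
\<open>V\<close>, so that the identity also makes sense for \<open>cos \<theta> = 0\<close>.\<close>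

lemma energy_identity:
  assumes "t \<in> I"
  shows "u t * (w t)\<^sup>2 + (v t)\<^sup>2 * c t ^ 6 + C\<^sup>2 * r t * c t ^ 4 - 2 * h * r t ^ 3 * c t ^ 6
    = 2 * u t * c t ^ 3 + 2 * (r t)\<^sup>2 * p t * c t ^ 5"
proof -
  have "V M m A A1 (\<theta> t) * (c t)\<^sup>2 = p t * c t"
  proof (cases "c t = 0")
    case False
    then have "p t = V M m A A1 (\<theta> t) * c t" by (simp add: Vt_def V_def distrib_right)
    then show ?thesis by (simp add: power2_eq_square)
  qed simp
  then have "(V M m A A1 (\<theta> t) * (c t)\<^sup>2) * (2 * (r t)\<^sup>2 * c t ^ 4) = (p t * c t) * (2 * (r t)\<^sup>2 * c t ^ 4)"
    by simp
  then have "2 * r t * V M m A A1 (\<theta> t) * (c t)\<^sup>2 * r t * c t ^ 4 = 2 * (r t)\<^sup>2 * p t * c t ^ 5"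
    by (simp add: numeral_eq_Suc mult_ac)
  moreover have "(C\<^sup>2 - 2 * r t * V M m A A1 (\<theta> t) * (c t)\<^sup>2) * r t * c t ^ 4
    = C\<^sup>2 * r t * c t ^ 4 - 2 * r t * V M m A A1 (\<theta> t) * (c t)\<^sup>2 * r t * c t ^ 4"
    by (simp add: left_diff_distrib)
  moreover have "((v t)\<^sup>2 * c t ^ 3 - 2 * u t) * c t ^ 3 = (v t)\<^sup>2 * c t ^ 6 - 2 * u t * c t ^ 3"
    by (simp add: left_diff_distrib mult.assoc flip: power_add)
  ultimately show ?thesis using energy[OF assms] unfolding energy_relation_def by simp
qed

text \<open>While \<open>r \<le> R\<close>, the right-hand side of \<open>energy_identity\<close> is at most \<open>K R * cos\<^sup>3 \<theta>\<close>.\<close>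

definition "K R = 2 * U_max + 2 * R\<^sup>2 * V_max"

lemma K_nonneg: "K R \<ge> 0" using U_max_pos V_max_nonneg by (simp add: K_def)

lemma velocity_bounds:
  assumes "t \<in> I" "r t \<le> R"
  shows "U_min * (w t)\<^sup>2 \<le> K R * c t ^ 3" and "(v t)\<^sup>2 * c t ^ 6 \<le> K R * c t ^ 3"
proof -
  note c = c_nonneg[OF assms(1)] and u = u_bounds[OF assms(1)] and p = p_bounds[OF assms(1)]
    and r = r_nonneg[OF assms(1)]
  have "(r t)\<^sup>2 * p t * c t ^ 5 \<le> R\<^sup>2 * V_max * c t ^ 3"
    using r assms(2) p c by (intro mult_mono power_mono power_decreasing) auto
  moreover have "u t * c t ^ 3 \<le> U_max * c t ^ 3" using u c by (intro mult_right_mono) auto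
  ultimately have rhs: "2 * u t * c t ^ 3 + 2 * (r t)\<^sup>2 * p t * c t ^ 5 \<le> K R * c t ^ 3"
    unfolding K_def distrib_right by simp
  have "h * (r t ^ 3 * c t ^ 6) \<le> 0" using h r c by (intro mult_nonpos_nonneg) auto
  moreover have "0 \<le> C\<^sup>2 * r t * c t ^ 4" using r by simp
  moreover have "0 \<le> u t * (w t)\<^sup>2" "0 \<le> (v t)\<^sup>2 * c t ^ 6" using u by auto
  moreover have "U_min * (w t)\<^sup>2 \<le> u t * (w t)\<^sup>2" using u by (intro mult_right_mono) auto
  ultimately show "U_min * (w t)\<^sup>2 \<le> K R * c t ^ 3" "(v t)\<^sup>2 * c t ^ 6 \<le> K R * c t ^ 3"
    using energy_identity[OF assms(1)] rhs unfolding mult.assoc by linarith+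
qed

lemma interval_subset: "a \<in> I \<Longrightarrow> b \<in> I \<Longrightarrow> {a..b} \<subseteq> I"
  using interval unfolding is_interval_1 by (meson atLeastAtMost_iff subsetI)

lemma cos_deriv:
  "t \<in> I \<Longrightarrow> (c has_real_derivative - sin (\<theta> t) * w t) (at t within I)"
  by (auto intro!: derivative_eq_intros \<theta>_deriv)

definition "L R = sqrt (K R / U_min)"

lemma L_nonneg: "L R \<ge> 0" using K_nonneg U_min_pos by (simp add: L_def)

lemma w_sq_bound:
  assumes "t \<in> I" "r t \<le> R"
  shows "(w t)\<^sup>2 \<le> (L R)\<^sup>2 * c t ^ 3"
  using velocity_bounds(1)[OF assms] U_min_pos K_nonneg[of R] by (simp add: L_def field_simps)

lemma w_bound:
  assumes "t \<in> I" "r t \<le> R"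
  shows "\<bar>w t\<bar> \<le> L R * c t"
proof (rule power2_le_imp_le)
  have "(L R)\<^sup>2 * c t ^ 3 \<le> (L R)\<^sup>2 * c t ^ 2"
    using c_nonneg[OF assms(1)] by (intro mult_left_mono power_decreasing) auto
  then show "\<bar>w t\<bar>\<^sup>2 \<le> (L R * c t)\<^sup>2" using w_sq_bound[OF assms] by (simp add: power_mult_distrib)
  show "0 \<le> L R * c t" using L_nonneg c_nonneg[OF assms(1)] by simp
qed

text \<open>The derivative of \<open>cos \<theta>\<close> is at most \<open>\<bar>w\<bar> \<le> L R * cos \<theta>\<close> in absolute value, so \<open>cos \<theta>\<close> decays at
most exponentially.\<close>

lemma cos_lower_bound:
  assumes "t \<in> I" "\<And>s. s \<in> {0..t} \<Longrightarrow> r s \<le> R"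
  shows "c t \<ge> c 0 * exp (- L R * t)"
proof -
  have t: "0 \<le> t" using assms(1) nonneg_time by auto
  have sub: "{0..t} \<subseteq> I" by (rule interval_subset[OF zero_in assms(1)])
  have "c t \<ge> c 0 * exp (- L R * (t - 0))"
  proof (rule exponential_lower_bound[OF t])
    fix s assume s: "s \<in> {0..t}"
    then show "(c has_real_derivative - sin (\<theta> s) * w s) (at s within {0..t})"
      using sub by (intro DERIV_subset[OF cos_deriv]) auto
    have "sin (\<theta> s) * w s \<le> \<bar>w s\<bar>"
      by (metis abs_le_D1 abs_mult abs_sin_le_one mult_left_le_one_le abs_ge_zero)
    then show "- L R * c s \<le> - sin (\<theta> s) * w s"
      using w_bound[of s R] s sub assms(2) by fastforce
  qed
  then show ?thesis by simp
qed

lemma cos_0_pos: "c 0 > 0"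
  using \<theta>_init by (intro cos_gt_zero_pi) auto

lemma r_continuous: "continuous_on I r"
  using r_deriv by (rule DERIV_continuous_on)
lemma v_continuous: "continuous_on I v"
  using v_deriv by (rule DERIV_continuous_on)
lemma \<theta>_continuous: "continuous_on I \<theta>"
  using \<theta>_deriv by (rule DERIV_continuous_on)

text \<open>Double collisions do not occur in finite time. At this stage \<open>r\<close> is only known to be bounded on the
compact interval \<open>{0..t}\<close>; a bound that is uniform in time follows later from monotonicity.\<close>

lemma cos_pos:
  assumes "t \<in> I"
  shows "c t > 0"
proof -
  have "continuous_on {0..t} r"
    using r_continuous interval_subset[OF zero_in assms] continuous_on_subset by blast
  then have "bounded (r ` {0..t})" by (intro compact_imp_bounded compact_continuous_image) auto
  then obtain R where R: "\<forall>z\<in>r ` {0..t}. norm z \<le> R" unfolding bounded_iff ..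
  have "c 0 * exp (- L R * t) \<le> c t"
  proof (rule cos_lower_bound[OF assms])
    show "r s \<le> R" if "s \<in> {0..t}" for s
      using R[rule_format, OF imageI[OF that]] by simp
  qed
  moreover have "0 < c 0 * exp (- L R * t)" using cos_0_pos by simp
  ultimately show ?thesis by linarith
qed

lemma \<theta>_interior: "t \<in> I \<Longrightarrow> \<bar>\<theta> t\<bar> < pi / 2"
proof (rule ccontr)
  assume "t \<in> I" "\<not> \<bar>\<theta> t\<bar> < pi / 2"
  then have "\<bar>\<theta> t\<bar> = pi / 2" using \<theta>_range[of t] by simp
  then have "cos \<bar>\<theta> t\<bar> = cos (pi / 2)" by (rule arg_cong)
  then show False using cos_pos[OF \<open>t \<in> I\<close>] by simp
qed

text \<open>The equation for \<open>r\<close> is linear in \<open>r\<close>, so triple collision does not occur in finite time either.\<close>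

lemma r_pos:
  assumes "t \<in> I"
  shows "r t > 0"
proof -
  have t: "0 \<le> t" using assms nonneg_time by auto
  have sub: "{0..t} \<subseteq> I" by (rule interval_subset[OF zero_in assms])
  define g where "g s = v s * (c s ^ 3 / sqrt (u s))" for s
  have "continuous_on I u" 
    by (rule continuous_on_compose2[OF continuous_U[OF M m] \<theta>_continuous]) auto
  then have "continuous_on I g"
    unfolding g_def using u_bounds(3) 
    by (auto intro!: continuous_intros v_continuous \<theta>_continuous simp: less_imp_neq[symmetric])
  then have "bounded (g ` {0..t})"
    using sub continuous_on_subset by (intro compact_imp_bounded compact_continuous_image) auto
  then obtain b where b: "\<forall>z\<in>g ` {0..t}. norm z \<le> b" unfolding bounded_iff ..
  have "r t \<ge> r 0 * exp (- b * (t - 0))"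
  proof (rule exponential_lower_bound[OF t])
    fix s assume s: "s \<in> {0..t}"
    then show "(r has_real_derivative r s * g s) (at s within {0..t})"
      using sub unfolding g_def mult.assoc[symmetric]
      by (intro DERIV_subset[OF r_deriv[unfolded mult.assoc[symmetric]]]) (auto simp: mult.assoc)
    have "- b \<le> g s" using b[rule_format, OF imageI[OF s]] by simp
    then have "r s * (- b) \<le> r s * g s" using r_nonneg[of s] s sub by (intro mult_left_mono) auto
    then show "- b * r s \<le> r s * g s" by (simp add: mult.commute)
  qed
  moreover have "0 < r 0 * exp (- b * (t - 0))" using r_init by simp
  ultimately show ?thesis by linarith
qed

text \<open>Eliminating \<open>v\<^sup>2\<close> through the energy relation leaves only terms of one sign: the smallness of
\<open>r 0\<close> makes the angular momentum term dominate the Newtonian attraction.\<close>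

lemma v_deriv_nonpos:
  assumes "t \<in> I" "r t \<le> r 0"
  shows "(c t ^ 3 / (2 * sqrt (u t)) * (v t)\<^sup>2 - sqrt (u t))
        + (r t)\<^sup>2 * (2 * h * r t + V M m A A1 (\<theta> t)) * (c t ^ 3 / sqrt (u t)) \<le> 0" (is "?v' \<le> 0")
proof -
  note c = cos_pos[OF assms(1)] and u = u_bounds(3)[OF assms(1)] and p = p_bounds[OF assms(1)]
    and r = r_pos[OF assms(1)]
  have p_eq: "p t = V M m A A1 (\<theta> t) * c t" using c by (simp add: Vt_def V_def distrib_right)
  have "2 * c t ^ 3 * (?v' * sqrt (u t)) = (v t)\<^sup>2 * c t ^ 6 - 2 * u t * c t ^ 3
      + 4 * h * r t ^ 3 * c t ^ 6 + 2 * (r t)\<^sup>2 * p t * c t ^ 5"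
    unfolding p_eq using u by (simp add: field_simps numeral_eq_Suc)
  also have "\<dots> = 6 * h * r t ^ 3 * c t ^ 6 - u t * (w t)\<^sup>2
      - 2 * r t * c t ^ 4 * (C\<^sup>2 / 2 - 2 * r t * (p t * c t))"
    using energy_identity[OF assms(1)] by (simp add: algebra_simps numeral_eq_Suc)
  also have "\<dots> \<le> 0"
  proof -
    have "p t * c t \<le> V_max * 1" using p c V_max_nonneg by (intro mult_mono) auto
    then have "r t * (p t * c t) \<le> r 0 * V_max"
      using r assms(2) V_max_nonneg p c by (intro mult_mono) auto
    then have "0 \<le> C\<^sup>2 / 2 - 2 * r t * (p t * c t)" using small by (simp add: V_max_def)
    then have "0 \<le> 2 * r t * c t ^ 4 * (C\<^sup>2 / 2 - 2 * r t * (p t * c t))"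
      using r c by (intro mult_nonneg_nonneg) auto
    moreover have "0 \<le> (- h) * (r t ^ 3 * c t ^ 6)" using h r c by (intro mult_nonneg_nonneg) auto
    moreover have "0 \<le> u t * (w t)\<^sup>2" using u by simp
    ultimately show ?thesis by (simp add: mult.assoc)
  qed
  finally show ?thesis using c u by (simp add: mult_le_0_iff zero_le_mult_iff)
qed

lemma r_le_of_v_neg:
  assumes "a \<in> I" "b \<in> I" "a \<le> b" "\<And>s. s \<in> {a..b} \<Longrightarrow> v s \<le> 0"
  shows "r b \<le> r a"
proof -
  have sub: "{a..b} \<subseteq> I" by (rule interval_subset[OF assms(1,2)])
  have "- r a \<le> - r b"
  proof (rule nondecreasing_within[OF \<open>a \<le> b\<close>])
    show "((\<lambda>s. - r s) has_real_derivative - (r s * v s * (c s ^ 3 / sqrt (u s)))) (at s within {a..b})"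
      if "s \<in> {a..b}" for s
      using that sub by (intro DERIV_minus DERIV_subset[OF r_deriv]) auto
    show "0 \<le> - (r s * v s * (c s ^ 3 / sqrt (u s)))" if "s \<in> {a..b}" for s
    proof -
      have "0 \<le> r s * (- v s) * (c s ^ 3 / sqrt (u s))"
        using that sub assms(4) r_nonneg c_nonneg u_bounds(3)
        by (intro mult_nonneg_nonneg divide_nonneg_nonneg) (auto simp: less_imp_le subset_iff)
      then show ?thesis by simp
    qed
  qed
  then show ?thesis by simp
qed

lemma v_le_of_r_le:
  assumes "t \<in> I" "\<And>s. s \<in> {0..t} \<Longrightarrow> r s \<le> r 0"
  shows "v t \<le> v 0"
proof -
  have t: "0 \<le> t" using assms nonneg_time by auto
  have sub: "{0..t} \<subseteq> I" by (rule interval_subset[OF zero_in assms(1)])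
  have "- v 0 \<le> - v t"
    by (rule nondecreasing_within[OF t DERIV_minus[OF DERIV_subset[OF v_deriv sub]]])
      (use sub v_deriv_nonpos assms(2) in fastforce)+
  then show ?thesis by simp
qed

text \<open>At the first time \<open>\<tau>\<close> with \<open>v \<tau> \<ge> 0\<close>, the radius would not have grown before \<open>\<tau>\<close>, hence \<open>v\<close> would
not have grown either, and \<open>v \<tau> \<le> v 0 < 0\<close>.\<close>

lemma v_neg:
  assumes "t \<in> I"
  shows "v t < 0"
proof (rule ccontr)
  assume vt: "\<not> v t < 0"
  have t: "0 \<le> t" using assms nonneg_time by auto
  have sub: "{0..t} \<subseteq> I" by (rule interval_subset[OF zero_in assms])
  define S where "S = {s \<in> {0..t}. v s \<ge> 0}"
  have S_eq: "S = {0..t} \<inter> v -` {0..}" by (auto simp: S_def)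
  have "closed S"
    unfolding S_eq using v_continuous sub
    by (intro continuous_closed_preimage) (auto intro: continuous_on_subset)
  moreover have "bdd_below S" by (auto simp: S_def bdd_below_def)
  moreover have "S \<noteq> {}" using vt t by (auto simp: S_def)
  ultimately have inf: "Inf S \<in> S" by (intro closed_contains_Inf)
  define \<tau> where "\<tau> = Inf S"
  have \<tau>: "\<tau> \<in> {0..t}" "v \<tau> \<ge> 0" using inf by (auto simp: \<tau>_def S_def)
  have before: "v s < 0" if "0 \<le> s" "s < \<tau>" for s
  proof (rule ccontr)
    assume "\<not> v s < 0"
    then have "s \<in> S" using that \<tau> by (auto simp: S_def)
    then have "\<tau> \<le> s" unfolding \<tau>_def using \<open>bdd_below S\<close> by (rule cInf_lower)
    then show False using that by simp
  qed
  have le: "r s \<le> r 0" if "s \<in> {0..<\<tau>}" for s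
    using that before \<tau> sub by (intro r_le_of_v_neg[OF zero_in]) (auto intro!: less_imp_le)
  have "r s \<le> r 0" if s: "s \<in> {0..\<tau>}" for s
  proof (cases "s = \<tau> \<and> 0 < \<tau>")
    case True
    have "closure {0..<\<tau>} = {0..\<tau>}" using True by simp
    moreover have "continuous_on {0..\<tau>} r"
      using r_continuous by (rule continuous_on_subset) (use \<tau> sub in auto)
    ultimately show ?thesis
      using continuous_le_on_closure[of "{0..<\<tau>}" r s "r 0"] le s by simp
  next
    case False
    then show ?thesis using le[of s] s by (cases "s < \<tau>") auto
  qed
  then have "v \<tau> \<le> v 0" using \<tau> sub by (intro v_le_of_r_le) auto
  then show False using \<tau> v_init by simp
qed

lemma r_antimono:
  assumes "a \<in> I" "b \<in> I" "a \<le> b"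
  shows "r b \<le> r a"
proof (rule r_le_of_v_neg[OF assms])
  show "v s \<le> 0" if "s \<in> {a..b}" for s
    using v_neg[of s] that interval_subset[OF assms(1,2)] by fastforce
qed

lemma r_le_init: "t \<in> I \<Longrightarrow> r t \<le> r 0"
  using nonneg_time by (intro r_antimono zero_in) auto

lemma v_le_init:
  assumes "t \<in> I"
  shows "v t \<le> v 0"
  using interval_subset[OF zero_in assms] r_le_init by (intro v_le_of_r_le[OF assms]) auto

lemma r_drops:
  assumes "t \<in> I" "t > 0"
  obtains s where "s \<in> I" "r s < r 0"
proof -
  have "r 0 * v 0 * (c 0 ^ 3 / sqrt (u 0)) < 0"
    using r_init v_init cos_0_pos u_bounds(3)[OF zero_in]
    by (intro mult_neg_pos mult_pos_neg divide_pos_pos) auto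
  then obtain d where d: "d > 0" "\<And>s. s > 0 \<Longrightarrow> 0 + s \<in> I \<Longrightarrow> s < d \<Longrightarrow> r (0 + s) < r 0"
    using has_real_derivative_neg_dec_right[OF r_deriv[OF zero_in]] by metis
  have "min t (d / 2) \<in> I" using interval_subset[OF zero_in assms(1)] assms(2) d(1) by auto
  then show ?thesis using that[of "min t (d / 2)"] d(2)[of "min t (d / 2)"] d(1) assms(2) by auto
qed

end

section \<open>Asymptotic behaviour\<close>

lemma dist_state_le:
  fixes a b c d a' b' c' d' :: real
  shows "dist (a, b, c, d) (a', b', c', d') \<le> \<bar>a - a'\<bar> + \<bar>b - b'\<bar> + \<bar>c - c'\<bar> + \<bar>d - d'\<bar>"
proof -
  have pair: "dist (p, q) (p', q') \<le> dist p p' + dist q q'" for p p' :: "'x::metric_space" and q q' :: "'y::metric_space"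
    unfolding dist_Pair_Pair by (rule sqrt_sum_squares_le_sum) auto
  show ?thesis
    using pair[of a "(b, c, d)" a' "(b', c', d')"] pair[of b "(c, d)" b' "(c', d')"] pair[of c d c' d']
    by (simp add: dist_real_def)
qed

context collapsing_orbit
begin

lemma v_bound:
  assumes "t \<in> I" "\<delta> > 0" "\<delta> \<le> c t"
  shows "\<bar>v t\<bar> \<le> sqrt (K (r 0) / \<delta> ^ 3)"
proof -
  have c: "c t > 0" by (rule cos_pos[OF assms(1)])
  have "(v t)\<^sup>2 * c t ^ 3 * c t ^ 3 \<le> K (r 0) * c t ^ 3"
    using velocity_bounds(2)[OF assms(1) r_le_init[OF assms(1)]] by (simp add: mult.assoc flip: power_add)
  then have "(v t)\<^sup>2 * c t ^ 3 \<le> K (r 0)" by (rule mult_right_le_imp_le) (use c in simp)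
  moreover have "(v t)\<^sup>2 * \<delta> ^ 3 \<le> (v t)\<^sup>2 * c t ^ 3"
    using assms by (intro mult_left_mono power_mono) auto
  ultimately have "(v t)\<^sup>2 \<le> K (r 0) / \<delta> ^ 3" using assms(2) by (simp add: pos_le_divide_eq)
  then show ?thesis by (intro real_le_rsqrt) simp
qed

lemma w_le: "t \<in> I \<Longrightarrow> \<bar>w t\<bar> \<le> L (r 0)"
  using w_bound[OF _ r_le_init, of t] mult_left_le[OF cos_le_one L_nonneg, of "r 0" "\<theta> t"] by simp

text \<open>With \<open>r \<le> r 0\<close> established, the lower bound on \<open>cos \<theta>\<close> depends only on \<open>T\<close>, and it controls \<open>v\<close>,
the one coordinate that may be unbounded as time tends to infinity.\<close>

lemma compact_confinement:
  assumes "T > 0"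
  obtains S where "compact S" "S \<subseteq> {(r, v, \<theta>, w). r \<ge> 0 \<and> \<bar>\<theta>\<bar> < pi / 2}"
    "\<And>t. t \<in> I \<Longrightarrow> t < T \<Longrightarrow> (r t, v t, \<theta> t, w t) \<in> S"
proof
  define \<delta> where "\<delta> = c 0 * exp (- L (r 0) * T)"
  define b where "b = sqrt (K (r 0) / \<delta> ^ 3)"
  have \<delta>: "\<delta> > 0" using cos_0_pos by (simp add: \<delta>_def)
  define S where "S = {0..r 0} \<times> {-b..b} \<times> ({- (pi / 2)..pi / 2} \<inter> cos -` {\<delta>..}) \<times> {- L (r 0)..L (r 0)}"
  have "closed ({- (pi / 2)..pi / 2} \<inter> cos -` {\<delta>..})"
    by (rule continuous_closed_preimage) (auto intro!: continuous_intros)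
  then have "compact ({- (pi / 2)..pi / 2} \<inter> cos -` {\<delta>..})"
    by (simp add: compact_eq_bounded_closed bounded_Int)
  then show "compact S" unfolding S_def by (intro compact_Times) auto
  show "S \<subseteq> {(r, v, \<theta>, w). r \<ge> 0 \<and> \<bar>\<theta>\<bar> < pi / 2}"
  proof clarify
    fix r' v' \<phi> w' assume "(r', v', \<phi>, w') \<in> S"
    then have \<phi>: "\<bar>\<phi>\<bar> \<le> pi / 2" "cos \<phi> \<ge> \<delta>" "r' \<ge> 0" by (auto simp: S_def)
    have "\<bar>\<phi>\<bar> \<noteq> pi / 2"
    proof
      assume "\<bar>\<phi>\<bar> = pi / 2"
      then have "cos \<bar>\<phi>\<bar> = cos (pi / 2)" by (rule arg_cong)
      then show False using \<phi> \<delta> by simp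
    qed
    then show "r' \<ge> 0 \<and> \<bar>\<phi>\<bar> < pi / 2" using \<phi> by simp
  qed
  fix t assume t: "t \<in> I" "t < T"
  have "0 \<le> t" using t nonneg_time by auto
  have "\<delta> \<le> c 0 * exp (- L (r 0) * t)"
    unfolding \<delta>_def using t cos_0_pos L_nonneg[of "r 0"] by (simp add: mult_left_mono)
  also have "\<dots> \<le> c t"
    using interval_subset[OF zero_in t(1)] r_le_init by (intro cos_lower_bound[OF t(1)]) auto
  finally have c: "\<delta> \<le> c t" .
  show "(r t, v t, \<theta> t, w t) \<in> S"
    using v_bound[OF t(1) \<delta> c] w_le[OF t(1)] r_nonneg[OF t(1)] r_le_init[OF t(1)] \<theta>_range[OF t(1)] c
    by (auto simp: S_def b_def abs_le_iff)
qed

definition "state t = (r t, v t, \<theta> t, w t)"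

lemma angle_from_cos:
  assumes "t \<in> I"
  shows "\<bar>\<theta> t\<bar> = arccos (c t)"
proof -
  have "\<bar>\<theta> t\<bar> \<le> pi" using \<theta>_range[OF assms] pi_gt_zero by linarith
  from arccos_cos[OF abs_ge_zero this] show ?thesis by simp
qed

lemma w_le_cos:
  assumes "t \<in> I"
  shows "\<bar>w t\<bar> \<le> L (r 0) * c t"
  using w_bound[OF assms r_le_init[OF assms]] .

lemma cos_lipschitz:
  assumes "0 \<le> s" "s \<le> t" "{0..t} \<subseteq> I"
  shows "\<bar>c t - c s\<bar> \<le> (L (r 0) + 1) * (t - s)"
proof -
  have "(L (r 0) + 1)-lipschitz_on {s..t} c"
  proof (rule bounded_derivative_imp_lipschitz)
    show "(c has_derivative (*) (- sin (\<theta> a) * w a)) (at a within {s..t})" if "a \<in> {s..t}" for a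
    proof -
      have "{s..t} \<subseteq> I" using assms by auto
      then show ?thesis
        using DERIV_subset[OF cos_deriv, of a "{s..t}"] that unfolding has_field_derivative_def by blast
    qed
    show "onorm ((*) (- sin (\<theta> a) * w a)) \<le> L (r 0) + 1" if "a \<in> {s..t}" for a
    proof (rule onorm_bound)
      have "\<bar>- sin (\<theta> a) * w a\<bar> \<le> 1 * L (r 0)"
        unfolding abs_mult using that assms by (intro mult_mono w_le) auto
      then have "\<bar>- sin (\<theta> a) * w a\<bar> * \<bar>y\<bar> \<le> (L (r 0) + 1) * \<bar>y\<bar>" for y
        by (intro mult_right_mono) auto
      then show "norm (- sin (\<theta> a) * w a * y) \<le> (L (r 0) + 1) * norm y" for y
        unfolding real_norm_def abs_mult[of _ y] .
    qed (use L_nonneg[of "r 0"] in simp)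
  qed (use L_nonneg[of "r 0"] in auto)
  from lipschitz_onD[OF this, of t s] show ?thesis using assms by (simp add: dist_real_def)
qed

text \<open>Here \<open>r\<close>, \<open>- v\<close> and \<open>1 / sqrt U\<close> are all bounded below by positive constants, so \<open>r\<close> loses at least
\<open>\<kappa> cos\<^sup>3 \<theta>\<close> per unit of time, and \<open>cos \<theta>\<close> has to tend to 0. The value of \<open>v\<close> is free on the
double collision manifolds, so convergence to them concerns \<open>r\<close>, \<open>\<theta>\<close> and \<open>w\<close>.\<close>

lemma tends_to_double_collision:
  assumes I: "I = {0..}" and lim: "(r \<longlongrightarrow> \<rho>) at_top" and ge: "\<And>t. 0 \<le> t \<Longrightarrow> \<rho> \<le> r t" and "\<rho> > 0"
  shows "tends_to_set state (B_plus \<rho>) \<or> tends_to_set state (B_minus \<rho>)"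
proof -
  define \<kappa> where "\<kappa> = \<rho> * (- v 0) / sqrt U_max"
  have "\<kappa> > 0" unfolding \<kappa>_def using \<open>\<rho> > 0\<close> v_init U_max_pos
    by (intro divide_pos_pos mult_pos_pos) auto
  have c_lim: "(c \<longlongrightarrow> 0) at_top"
  proof (rule rate_tendsto_zero[OF r_deriv[unfolded I] _ \<open>\<kappa> > 0\<close> _ _ _ lim ge])
    fix t :: real assume "0 \<le> t"
    then have t: "t \<in> I" using I by simp
    have "\<rho> * (- v 0) * (c t ^ 3 / sqrt U_max) \<le> r t * (- v t) * (c t ^ 3 / sqrt (u t))"
      using ge[OF \<open>0 \<le> t\<close>] v_le_init[OF t] v_neg[OF t] \<open>\<rho> > 0\<close> c_nonneg[OF t] u_bounds[OF t] v_init r_nonneg[OF t]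
      by (intro mult_mono frac_le mult_nonneg_nonneg divide_nonneg_nonneg) auto
    then show "r t * v t * (c t ^ 3 / sqrt (u t)) \<le> - \<kappa> * c t ^ 3" by (simp add: \<kappa>_def)
    show "0 \<le> c t" by (rule c_nonneg[OF t])
  next
    show "\<bar>c t - c s\<bar> \<le> (L (r 0) + 1) * (t - s)" if "0 \<le> s" "s \<le> t" for s t
      using that I by (intro cos_lipschitz) auto
    show "0 < L (r 0) + 1" using L_nonneg[of "r 0"] by simp
  qed auto
  have ev: "eventually (\<lambda>t. t \<in> I) at_top" using eventually_ge_at_top[of 0] I by simp
  have "((\<lambda>t. arccos (c t)) \<longlongrightarrow> arccos 0) at_top"
    by (rule isCont_tendsto_compose[OF _ c_lim]) (intro isCont_arccos, auto)
  then have "((\<lambda>t. arccos (c t)) \<longlongrightarrow> pi / 2) at_top" by simp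
  then have angle: "((\<lambda>t. \<bar>\<theta> t\<bar>) \<longlongrightarrow> pi / 2) at_top"
    by (rule Lim_transform_eventually) (use ev in \<open>eventually_elim, simp add: angle_from_cos\<close>)
  have w_lim: "((\<lambda>t. \<bar>w t\<bar>) \<longlongrightarrow> 0) at_top"
  proof (rule tendsto_sandwich[of "\<lambda>_. 0"])
    show "((\<lambda>t. L (r 0) * c t) \<longlongrightarrow> 0) at_top" using tendsto_mult_right_zero[OF c_lim] .
    show "eventually (\<lambda>t. \<bar>w t\<bar> \<le> L (r 0) * c t) at_top"
      using ev by eventually_elim (rule w_le_cos)
  qed auto
  have r_lim: "((\<lambda>t. \<bar>r t - \<rho>\<bar>) \<longlongrightarrow> 0) at_top"
    using lim by (simp add: tendsto_rabs_zero LIM_zero)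
  obtain N where N: "\<And>t. t \<ge> N \<Longrightarrow> \<bar>\<theta> t\<bar> > 0"
    using order_tendstoD(1)[OF angle, of 0] by (auto simp: eventually_at_top_linorder)
  define N' where "N' = max 0 N"
  have tends: "tends_to_set state S" 
    if S: "\<And>t. t \<ge> N' \<Longrightarrow> (\<rho>, v t, \<sigma> * (pi / 2), 0) \<in> S" 
      and \<sigma>: "\<And>t. t \<ge> N' \<Longrightarrow> \<theta> t = \<sigma> * \<bar>\<theta> t\<bar>" "\<bar>\<sigma>\<bar> = 1" for \<sigma> S
    unfolding tends_to_set_def
  proof (rule tendsto_sandwich[of "\<lambda>_. 0"])
    have "((\<lambda>t. \<bar>r t - \<rho>\<bar> + \<bar>\<bar>\<theta> t\<bar> - pi / 2\<bar> + \<bar>w t\<bar>) \<longlongrightarrow> 0 + 0 + 0) at_top"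
      by (intro tendsto_add r_lim w_lim tendsto_rabs_zero LIM_zero angle)
    then show "((\<lambda>t. \<bar>r t - \<rho>\<bar> + \<bar>\<bar>\<theta> t\<bar> - pi / 2\<bar> + \<bar>w t\<bar>) \<longlongrightarrow> 0) at_top" by simp
    show "eventually (\<lambda>t. infdist (state t) S \<le> \<bar>r t - \<rho>\<bar> + \<bar>\<bar>\<theta> t\<bar> - pi / 2\<bar> + \<bar>w t\<bar>) at_top"
      using eventually_ge_at_top[of N']
    proof eventually_elim
      case (elim t)
      have "\<bar>\<theta> t - \<sigma> * (pi / 2)\<bar> = \<bar>\<sigma> * (\<bar>\<theta> t\<bar> - pi / 2)\<bar>"
        using \<sigma>(1)[OF elim] by (simp only: right_diff_distrib)
      also have "\<dots> = \<bar>\<bar>\<theta> t\<bar> - pi / 2\<bar>" using \<sigma>(2) by (simp add: abs_mult)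
      finally have eq: "\<bar>\<theta> t - \<sigma> * (pi / 2)\<bar> = \<bar>\<bar>\<theta> t\<bar> - pi / 2\<bar>" .
      have "infdist (state t) S \<le> dist (state t) (\<rho>, v t, \<sigma> * (pi / 2), 0)"
        by (rule infdist_le[OF S[OF elim]])
      also have "\<dots> \<le> \<bar>r t - \<rho>\<bar> + \<bar>\<bar>\<theta> t\<bar> - pi / 2\<bar> + \<bar>w t\<bar>"
        unfolding state_def using dist_state_le[of "r t" "v t" "\<theta> t" "w t" \<rho> "v t" "\<sigma> * (pi / 2)" 0] eq by simp
      finally show ?case .
    qed
  qed (auto simp: infdist_nonneg)
  \<comment> \<open>\<open>\<theta>\<close> has no zero after time \<open>N'\<close>, so it keeps its sign there\<close>
  have "connected (\<theta> ` {N'..})"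
    by (intro connected_continuous_image continuous_on_subset[OF \<theta>_continuous]) (auto simp: I N'_def)
  then have conn: "is_interval (\<theta> ` {N'..})" by (simp add: is_interval_connected_1)
  have "0 \<notin> \<theta> ` {N'..}" using N by (auto simp: N'_def)
  with conn have same_sign: False if "a \<ge> N'" "b \<ge> N'" "\<theta> a \<le> 0" "0 \<le> \<theta> b" for a b
    using that unfolding is_interval_1 by (meson atLeast_iff imageI)
  show ?thesis
  proof (cases "\<theta> N' > 0")
    case True
    have "\<theta> t \<ge> 0" if "t \<ge> N'" for t
      using same_sign[of t N'] that True by fastforce
    then have "tends_to_set state (B_plus \<rho>)" by (intro tends[of 1]) (auto simp: B_plus_def)
    then show ?thesis ..
  next
    case False
    have "\<theta> t \<le> 0" if "t \<ge> N'" for t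
      using same_sign[of N' t] that False by fastforce
    then have "tends_to_set state (B_minus \<rho>)" by (intro tends[of "-1"]) (auto simp: B_minus_def)
    then show ?thesis ..
  qed
qed

text \<open>The amount by which a state violates the equation of the triple collision manifold; by the energy
relation it is \<open>r\<close> times a bounded quantity.\<close>

definition "defect t = (w t)\<^sup>2 + c t ^ 6 / u t * (v t)\<^sup>2 - 2 * c t ^ 3"

definition "D = (2 * r 0 * V_max + C\<^sup>2 + 2 * (- h) * (r 0)\<^sup>2) / U_min"

lemma D_nonneg: "D \<ge> 0"
  unfolding D_def using r_init V_max_nonneg U_min_pos h
  by (intro divide_nonneg_pos add_nonneg_nonneg mult_nonneg_nonneg) auto

lemma defect_bound:
  assumes "t \<in> I"
  shows "\<bar>defect t\<bar> \<le> D * r t"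
proof -
  note c = c_nonneg[OF assms] and u = u_bounds[OF assms] and p = p_bounds[OF assms]
    and r = r_nonneg[OF assms] and r0 = r_le_init[OF assms]
  have "u t * defect t = r t * (2 * r t * p t * c t ^ 5 - C\<^sup>2 * c t ^ 4 + 2 * h * (r t)\<^sup>2 * c t ^ 6)"
    using energy_identity[OF assms] u(3) by (simp add: defect_def algebra_simps power2_eq_square power3_eq_cube)
  then have eq: "defect t = r t * ((2 * r t * p t * c t ^ 5 - C\<^sup>2 * c t ^ 4 + 2 * h * (r t)\<^sup>2 * c t ^ 6) / u t)"
    using u(3) by (simp add: field_simps)
  have c1: "c t ^ n \<le> 1" for n using c by (intro power_le_one) auto
  have "\<bar>2 * r t * p t * c t ^ 5 - C\<^sup>2 * c t ^ 4 + 2 * h * (r t)\<^sup>2 * c t ^ 6\<bar>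
    \<le> 2 * r t * p t * c t ^ 5 + C\<^sup>2 * c t ^ 4 + 2 * (- h) * (r t)\<^sup>2 * c t ^ 6"
  proof -
    have "0 \<le> 2 * r t * p t * c t ^ 5" using r p c by (intro mult_nonneg_nonneg) auto
    moreover have "0 \<le> C\<^sup>2 * c t ^ 4" using c by simp
    moreover have "0 \<le> 2 * (- h) * (r t)\<^sup>2 * c t ^ 6" using h c by (intro mult_nonneg_nonneg) auto
    moreover have "2 * (- h) * (r t)\<^sup>2 * c t ^ 6 = - (2 * h * (r t)\<^sup>2 * c t ^ 6)" by simp
    ultimately show ?thesis unfolding abs_le_iff by linarith
  qed
  also have "\<dots> \<le> 2 * r 0 * V_max * 1 + C\<^sup>2 * 1 + 2 * (- h) * (r 0)\<^sup>2 * 1"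
  proof (intro add_mono)
    show "2 * r t * p t * c t ^ 5 \<le> 2 * r 0 * V_max * 1"
      using r r0 p c c1 V_max_nonneg by (intro mult_mono mult_nonneg_nonneg) auto
    show "C\<^sup>2 * c t ^ 4 \<le> C\<^sup>2 * 1" by (intro mult_left_mono c1) simp
    show "2 * (- h) * (r t)\<^sup>2 * c t ^ 6 \<le> 2 * (- h) * (r 0)\<^sup>2 * 1"
      using r r0 h c1 by (intro mult_mono power_mono mult_nonneg_nonneg) auto
  qed
  finally have "\<bar>2 * r t * p t * c t ^ 5 - C\<^sup>2 * c t ^ 4 + 2 * h * (r t)\<^sup>2 * c t ^ 6\<bar> / u t \<le> D"
    unfolding D_def using u U_min_pos r_init h V_max_nonneg by (intro frac_le) auto
  then have "r t * (\<bar>2 * r t * p t * c t ^ 5 - C\<^sup>2 * c t ^ 4 + 2 * h * (r t)\<^sup>2 * c t ^ 6\<bar> / u t) \<le> r t * D"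
    using r by (intro mult_left_mono)
  then show ?thesis unfolding eq using r u(3) by (simp add: abs_mult mult.commute)
qed

text \<open>Where \<open>cos \<theta>\<close> is small, \<open>v\<close> may be huge, and adjusting it would be costly. The sets \<open>B_plus 0\<close> and
\<open>B_minus 0\<close> contain a point of the manifold with the same \<open>v\<close>.\<close>

lemma infdist_small_cos:
  assumes "t \<in> I"
  shows "infdist (state t) (triple_collision_manifold M m B B1)
    \<le> r t + (\<bar>arccos (c t) - pi / 2\<bar> + L (r 0) * c t)"
proof -
  define \<sigma> where "\<sigma> = (if \<theta> t \<ge> 0 then pi / 2 else - (pi / 2))"
  have "(0, v t, \<sigma>, 0) \<in> triple_collision_manifold M m B B1"
    using B_plus_0_subset[of M m B B1] B_minus_0_subset[of M m B B1] 
    by (auto simp: \<sigma>_def B_plus_def B_minus_def)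
  then have "infdist (state t) (triple_collision_manifold M m B B1) \<le> dist (state t) (0, v t, \<sigma>, 0)"
    by (rule infdist_le)
  also have "\<dots> \<le> \<bar>r t\<bar> + \<bar>\<theta> t - \<sigma>\<bar> + \<bar>w t\<bar>"
    unfolding state_def using dist_state_le[of "r t" "v t" "\<theta> t" "w t" 0 "v t" \<sigma> 0] by simp
  also have "\<bar>\<theta> t - \<sigma>\<bar> = \<bar>\<bar>\<theta> t\<bar> - pi / 2\<bar>" by (auto simp: \<sigma>_def)
  finally show ?thesis
    using w_le_cos[OF assms] r_nonneg[OF assms] angle_from_cos[OF assms] by simp
qed

text \<open>Where \<open>cos \<theta>\<close> is bounded below, \<open>v\<close> and \<open>w\<close> are bounded, and the point is moved onto the manifold
by multiplying both by a factor \<open>\<gamma>\<close> that is close to 1 when the defect is small.\<close>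

lemma infdist_large_cos:
  assumes t: "t \<in> I" and "\<delta> > 0" "\<delta> \<le> c t" and small_r: "D * r t \<le> \<delta> ^ 3"
  shows "infdist (state t) (triple_collision_manifold M m B B1)
    \<le> r t * (1 + D / \<delta> ^ 3 * (sqrt (K (r 0) / \<delta> ^ 3) + L (r 0)))"
proof -
  define s where "s = 2 * c t ^ 3 + defect t"
  define \<gamma> where "\<gamma> = sqrt (2 * c t ^ 3 / s)"
  have c: "c t > 0" by (rule cos_pos[OF t])
  have "\<delta> ^ 3 \<le> c t ^ 3" using assms by (intro power_mono) auto
  then have s: "s \<ge> \<delta> ^ 3"
    using defect_bound[OF t] small_r unfolding s_def by linarith
  have "\<delta> ^ 3 > 0" using \<open>\<delta> > 0\<close> by simp
  then have "s > 0" using s by linarith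
  have \<gamma>2: "\<gamma>\<^sup>2 = 2 * c t ^ 3 / s" and "\<gamma> \<ge> 0" 
    using \<open>s > 0\<close> c by (auto simp: \<gamma>_def)
  have "\<gamma>\<^sup>2 * ((w t)\<^sup>2 + c t ^ 6 / u t * (v t)\<^sup>2) = 2 * c t ^ 3"
    using \<open>s > 0\<close> unfolding \<gamma>2 s_def defect_def by simp
  then have "(0, \<gamma> * v t, \<theta> t, \<gamma> * w t) \<in> triple_collision_manifold M m B B1"
    using \<theta>_range[OF t] 
    by (auto simp: triple_collision_manifold_def state_space_def power_mult_distrib algebra_simps abs_le_iff)
  then have "infdist (state t) (triple_collision_manifold M m B B1) \<le> dist (state t) (0, \<gamma> * v t, \<theta> t, \<gamma> * w t)"
    by (rule infdist_le)
  also have "\<dots> \<le> \<bar>r t\<bar> + (\<bar>v t - \<gamma> * v t\<bar> + \<bar>w t - \<gamma> * w t\<bar>)"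
    unfolding state_def using dist_state_le[of "r t" "v t" "\<theta> t" "w t" 0 "\<gamma> * v t" "\<theta> t" "\<gamma> * w t"] by simp
  also have "\<bar>v t - \<gamma> * v t\<bar> + \<bar>w t - \<gamma> * w t\<bar> = \<bar>1 - \<gamma>\<bar> * (\<bar>v t\<bar> + \<bar>w t\<bar>)"
    by (simp add: distrib_left flip: abs_mult) (simp add: left_diff_distrib)
  finally have dist: "infdist (state t) (triple_collision_manifold M m B B1)
    \<le> r t + \<bar>1 - \<gamma>\<bar> * (\<bar>v t\<bar> + \<bar>w t\<bar>)" using r_nonneg[OF t] by simp
  have "\<bar>1 - \<gamma>\<bar> \<le> \<bar>1 - \<gamma>\<bar> * (1 + \<gamma>)" using \<open>\<gamma> \<ge> 0\<close> mult_left_mono[of 1 "1 + \<gamma>" "\<bar>1 - \<gamma>\<bar>"] by simp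
  also have "\<dots> = \<bar>1 - \<gamma>\<^sup>2\<bar>"
    using \<open>\<gamma> \<ge> 0\<close> abs_mult[of "1 - \<gamma>" "1 + \<gamma>"] by (simp add: power2_eq_square algebra_simps)
  also have "1 - \<gamma>\<^sup>2 = defect t / s" using \<open>s > 0\<close> unfolding \<gamma>2 by (simp add: s_def field_simps)
  also have "\<bar>defect t / s\<bar> \<le> D * r t / \<delta> ^ 3"
    unfolding abs_divide using defect_bound[OF t] s \<open>s > 0\<close> \<open>\<delta> ^ 3 > 0\<close> by (intro frac_le) auto
  finally have "\<bar>1 - \<gamma>\<bar> * (\<bar>v t\<bar> + \<bar>w t\<bar>) \<le> D * r t / \<delta> ^ 3 * (sqrt (K (r 0) / \<delta> ^ 3) + L (r 0))"
    using v_bound[OF t assms(2,3)] w_le[OF t] D_nonneg r_nonneg[OF t] \<open>\<delta> ^ 3 > 0\<close>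
    by (intro mult_mono add_mono) auto
  then show ?thesis using dist by (simp add: algebra_simps)
qed

lemma tends_to_triple_collision:
  assumes I: "I = {0..}" and lim: "(r \<longlongrightarrow> 0) at_top"
  shows "tends_to_set state (triple_collision_manifold M m B B1)"
  unfolding tends_to_set_def
proof (rule tendstoI)
  fix e :: real assume "e > 0"
  define \<phi> where "\<phi> y = \<bar>arccos y - pi / 2\<bar> + L (r 0) * y" for y
  have "isCont \<phi> 0" unfolding \<phi>_def by (intro continuous_intros isCont_arccos) auto
  then have "(\<phi> \<longlongrightarrow> 0) (at 0)" using isContD[of 0 \<phi>] by (simp add: \<phi>_def)
  then obtain \<delta> where \<delta>: "\<delta> > 0" "\<And>y. y \<noteq> 0 \<Longrightarrow> \<bar>y\<bar> < \<delta> \<Longrightarrow> \<bar>\<phi> y\<bar> < e / 2"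
    using \<open>e > 0\<close> unfolding LIM_eq by (metis diff_zero half_gt_zero real_norm_def)
  define Q where "Q = 1 + D / \<delta> ^ 3 * (sqrt (K (r 0) / \<delta> ^ 3) + L (r 0))"
  have "((\<lambda>t. D * r t) \<longlongrightarrow> 0) at_top" "((\<lambda>t. r t * Q) \<longlongrightarrow> 0) at_top"
    using tendsto_mult_right_zero[OF lim] tendsto_mult_left_zero[OF lim] by auto
  then have "eventually (\<lambda>t. D * r t < \<delta> ^ 3) at_top" "eventually (\<lambda>t. r t * Q < e) at_top"
    using zero_less_power[OF \<delta>(1), of 3] \<open>e > 0\<close> by (blast dest: order_tendstoD(2))+
  moreover have "eventually (\<lambda>t. r t < e / 2) at_top" using order_tendstoD(2)[OF lim half_gt_zero[OF \<open>e > 0\<close>]] .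
  ultimately show "eventually (\<lambda>t. dist (infdist (state t) (triple_collision_manifold M m B B1)) 0 < e) at_top"
    using eventually_ge_at_top[of 0]
  proof eventually_elim
    case (elim t)
    then have t: "t \<in> I" using I by simp
    have "infdist (state t) (triple_collision_manifold M m B B1) < e"
    proof (cases "c t < \<delta>")
      case True
      then have "\<bar>\<phi> (c t)\<bar> < e / 2" using \<delta>(2)[of "c t"] cos_pos[OF t] by simp
      then show ?thesis using infdist_small_cos[OF t] elim unfolding \<phi>_def by linarith
    next
      case False
      then show ?thesis using infdist_large_cos[OF t \<delta>(1)] elim unfolding Q_def by fastforce
    qed
    then show ?case by (simp add: infdist_nonneg)
  qed
qed

lemma collapse_dichotomy:
  assumes I: "I = {0..}"
  shows "(\<exists>\<rho>. 0 < \<rho> \<and> \<rho> < r 0 \<and> (tends_to_set state (B_plus \<rho>) \<or> tends_to_set state (B_minus \<rho>)))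
     \<or> tends_to_set state (triple_collision_manifold M m B B1)"
proof -
  obtain \<rho> where \<rho>: "0 \<le> \<rho>" "\<And>t. 0 \<le> t \<Longrightarrow> \<rho> \<le> r t" "(r \<longlongrightarrow> \<rho>) at_top"
    by (rule nonincreasing_bounded_tendsto[of r 0]) (use r_antimono r_nonneg I in auto)
  show ?thesis
  proof (cases "\<rho> = 0")
    case True
    then show ?thesis using tends_to_triple_collision[OF I] \<rho>(3) by simp
  next
    case False
    then have "\<rho> > 0" using \<rho>(1) by simp
    obtain s where "s \<in> I" "r s < r 0" by (rule r_drops[of 1]) (use I in auto)
    then have "\<rho> < r 0" using \<rho>(2)[of s] I by auto
    then show ?thesis using tends_to_double_collision[OF I \<rho>(3,2) \<open>\<rho> > 0\<close>] \<open>\<rho> > 0\<close> by blast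
  qed
qed

end

section \<open>Collapse or asymptotic double collision\<close>

theorem proposition7:
  fixes k M m A A1 B B1 C h :: real
    and r0 v0 \<theta>0 w0 :: real
    and I :: "real set" and x :: "real \<Rightarrow> state"
  assumes "m > 0" and "M > m"
    and "A > 0" and "A1 > 0" and "B > 0" and "B1 > 0"
    and "mass_ratio M m > 1 + A / (4 * A1)"
    and "mass_ratio M m > 1 + B / (16 * B1)"
    and "(mass_ratio M m - 1) powr (4/15) * (4 * A1 / A) powr (2/3) \<noteq> (16 * B1 / B) powr (2/5)"
    and "h < 0"
    and "k \<in> {0, 3}"
    and "maximal_forward_solution (vfield k M m A A1 B B1 C h) I x"
    and "\<forall>t\<in>I. energy_relation M m A A1 B B1 C h (x t)"
    and "x 0 = (r0, v0, \<theta>0, w0)"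
    and "r0 > 0" and "\<bar>\<theta>0\<bar> < pi / 2"
    and "2 * r0 * Vt M m A A1 0 < C\<^sup>2 / 2" and "v0 < 0"
  shows "I = {0..} \<and>
    ((\<exists>\<rho>. 0 < \<rho> \<and> \<rho> < r0 \<and> (tends_to_set x (B_plus \<rho>) \<or> tends_to_set x (B_minus \<rho>)))
     \<or> tends_to_set x (triple_collision_manifold M m B B1))"
proof -
  let ?F = "vfield k M m A A1 B B1 C h"
  have "M > 0" using assms(1,2) by simp
  note vfield_lip = vfield_lipschitz_near[OF \<open>M > 0\<close> \<open>m > 0\<close> \<open>B > 0\<close> \<open>B1 > 0\<close>]
  define r where "r t = fst (x t)" for t
  define v where "v t = fst (snd (x t))" for t
  define \<theta> where "\<theta> t = fst (snd (snd (x t)))" for t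
  define w where "w t = snd (snd (snd (x t)))" for t
  have x: "x t = (r t, v t, \<theta> t, w t)" for t by (simp add: r_def v_def \<theta>_def w_def)
  have init: "r 0 = r0" "v 0 = v0" "\<theta> 0 = \<theta>0" using assms(14) by (simp_all add: r_def v_def \<theta>_def)
  have I: "is_interval I" "0 \<in> I" "I \<subseteq> {0..}" and sol: "solves_on ?F I x"
    using assms(12) by (auto simp: maximal_forward_solution_def)
  have x': "(x has_vector_derivative ?F (x t)) (at t within I)" and range: "x t \<in> state_space"
    if "t \<in> I" for t using sol that by (auto simp: solves_on_def)
  note fst' = bounded_linear.has_vector_derivative[OF bounded_linear_fst]
    and snd' = bounded_linear.has_vector_derivative[OF bounded_linear_snd]
  interpret collapsing_orbit M m A A1 B B1 C h I r v \<theta> w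
  proof
    fix t assume t: "t \<in> I"
    note d = x'[OF t]
    show "(r has_real_derivative r t * v t * (cos (\<theta> t) ^ 3 / sqrt (U M m B B1 (\<theta> t)))) (at t within I)"
      using fst'[OF d] unfolding r_def[symmetric] has_real_derivative_iff_has_vector_derivative
      by (simp add: x vfield_def Let_def r_def[symmetric])
    show "(v has_real_derivative
      (cos (\<theta> t) ^ 3 / (2 * sqrt (U M m B B1 (\<theta> t))) * (v t)\<^sup>2 - sqrt (U M m B B1 (\<theta> t)))
        + (r t)\<^sup>2 * (2 * h * r t + V M m A A1 (\<theta> t)) * (cos (\<theta> t) ^ 3 / sqrt (U M m B B1 (\<theta> t))))
      (at t within I)"
      using fst'[OF snd'[OF d]] unfolding v_def[symmetric] has_real_derivative_iff_has_vector_derivative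
      by (simp add: x vfield_def Let_def)
    show "(\<theta> has_real_derivative w t) (at t within I)"
      using fst'[OF snd'[OF snd'[OF d]]] unfolding \<theta>_def[symmetric] has_real_derivative_iff_has_vector_derivative
      by (simp add: x vfield_def Let_def)
    show "energy_relation M m A A1 B B1 C h (r t, v t, \<theta> t, w t)"
      using assms(13) t x by metis
    show "r t \<ge> 0" "\<bar>\<theta> t\<bar> \<le> pi / 2"
      using range[OF t] unfolding x by (auto simp: state_space_def abs_le_iff)
  qed (use assms \<open>M > 0\<close> I init in auto)
  have state: "state = x" by (simp add: fun_eq_iff state_def x)
  have "I = {0..}"
  proof (rule maximal_forward_solution_global[OF assms(12)])
    let ?D = "{0::real<..} \<times> (UNIV :: real set) \<times> {-(pi/2)<..<pi/2} \<times> (UNIV :: real set)"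
    show "open ?D" by (intro open_Times) auto
    show "?D \<subseteq> state_space" by (auto simp: state_space_def)
    show "lipschitz_near ?F z" if "z \<in> ?D" for z
    proof -
      obtain r' v' \<phi> w' where z: "z = (r', v', \<phi>, w')" by (cases z) auto
      show ?thesis using that unfolding z by (intro vfield_lip) auto
    qed
    show "x t \<in> ?D" if "t \<in> I" for t
      using r_pos[OF that] \<theta>_interior[OF that] by (auto simp: x abs_less_iff)
    fix T :: real assume T: "T > 0" "I = {0..<T}"
    obtain S where S: "compact S" "S \<subseteq> {(r, v, \<theta>, w). r \<ge> 0 \<and> \<bar>\<theta>\<bar> < pi / 2}"
      "\<And>t. t \<in> I \<Longrightarrow> t < T \<Longrightarrow> x t \<in> S"
      using compact_confinement[OF T(1)] unfolding x by metis
    have "continuous_on S ?F"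
      using S(2) by (intro continuous_on_subset[OF vfield_continuous_on]) (auto simp: assms \<open>M > 0\<close>)
    moreover have "S \<subseteq> state_space" using S(2) by (fastforce simp: state_space_def abs_less_iff)
    moreover have "x ` I \<subseteq> S" using S(3) T(2) by auto
    ultimately show "\<exists>K. compact K \<and> continuous_on K ?F \<and> K \<subseteq> state_space \<and> x ` I \<subseteq> K"
      using S(1) by blast
  qed
  then show ?thesis using collapse_dichotomy unfolding state init by simp
qed

end
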